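(* Let $\mathbb{E}[X_i]<\infty$, $i=1,2,\ldots$ (the jumps have finite mean). Let $Y_f(t)=\sum_{i=1}^{N_f(t)}X_i$, $t\ge0$, be the generalized fractional compound Poisson process. Then the compensated process $\{M_f(t)\}_{t\ge0}$ defined by $$M_f(t):=Y_f(t)-\lambda\,E_f(t)\,\mathbb{E}[X_1],\qquad t\ge0,$$ is a martingale with respect to the natural filtration $\mathscr{F}_t=\sigma(N_f(s),\,s\le t)\vee\sigma(E_f(s),\,s\le t)$.
   Context: Let $f(s)=bs+\int_0^\infty(1-e^{-sx})\,\nu(dx)$, $s>0$, be a Bernstein function with drift $b\ge 0$ and $\nu$ a non-negative L\'evy measure on the positive half-line satisfying $\int_0^\infty (x\wedge 1)\,\nu(dx)<\infty$ and $\nu([0,\infty))=\infty$. Let $\{D_f(t)\}_{t\ge0}$ be the L\'evy subordinator with $\mathbb{E}[e^{-sD_f(t)}]=e^{-tf(s)}$, and let $E_f(t)=\inf\{r\ge0: D_f(r)>t\}$ be its inverse. Let $\{N(t)\}_{t\ge0}$ be a Poisson process with intensity $\lambda>0$, independent of $\{E_f(t)\}_{t\ge0}$, and let $N_f(t)=N(E_f(t))$ be the time-changed Poisson process. Let $X_1,X_2,\dots$ be iid jumps with common distribution $F_X$, independent of the arrivals $N_f$. The generalized fractional compound Poisson process (GFCPP) is $Y_f(t)=\sum_{i=1}^{N_f(t)}X_i$, $t\ge0$.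
   Formalization: M_f is not adapted to F_t for random jumps, so it is shown to be a martingale for F_t enlarged by σ(Y_f(s), s≤t), together with E[M_f(t)−M_f(s)|F_s]=0 for the stated F_s; the jumps are taken independent of the pair (N_f, E_f). *)

theory Defs
  imports "HOL-Probability.Probability"
begin

text \<open>All processes are indexed by the reals but only their values at times \<open>t \<ge> 0\<close> matter.\<close>

definition levy_measure_pos :: "real measure \<Rightarrow> bool" where
  "levy_measure_pos \<nu> \<longleftrightarrow>
     sets \<nu> = sets borel \<and> emeasure \<nu> {..0} = 0 \<and>
     (\<integral>\<^sup>+x\<in>{0<..}. ennreal (min x 1) \<partial>\<nu>) < \<infinity>"

definition bernstein_fun :: "real \<Rightarrow> real measure \<Rightarrow> real \<Rightarrow> real" where
  "bernstein_fun b \<nu> s = b * s + (LINT x:{0<..}|\<nu>. 1 - exp (- s * x))"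

definition indep_increments :: "'a measure \<Rightarrow> (real \<Rightarrow> 'a \<Rightarrow> real) \<Rightarrow> bool" where
  "indep_increments M Z \<longleftrightarrow>
     (\<forall>(n::nat) t. 0 \<le> t 0 \<and> (\<forall>i<n. t i \<le> t (Suc i)) \<longrightarrow>
        prob_space.indep_vars M (\<lambda>_. borel) (\<lambda>i \<omega>. Z (t (Suc i)) \<omega> - Z (t i) \<omega>) {..<n})"

definition stationary_increments :: "'a measure \<Rightarrow> (real \<Rightarrow> 'a \<Rightarrow> real) \<Rightarrow> bool" where
  "stationary_increments M Z \<longleftrightarrow>
     (\<forall>s t. 0 \<le> s \<and> s \<le> t \<longrightarrow>
        distr M borel (\<lambda>\<omega>. Z t \<omega> - Z s \<omega>) = distr M borel (\<lambda>\<omega>. Z (t - s) \<omega> - Z 0 \<omega>))"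

text \<open>Nondecreasing right-continuous paths; left limits then exist automatically.\<close>

definition increasing_cadlag_paths :: "'a measure \<Rightarrow> (real \<Rightarrow> 'a \<Rightarrow> real) \<Rightarrow> bool" where
  "increasing_cadlag_paths M Z \<longleftrightarrow>
     (\<forall>\<omega>\<in>space M. mono_on {0..} (\<lambda>t. Z t \<omega>) \<and>
        (\<forall>t\<ge>0. continuous (at_right t) (\<lambda>t. Z t \<omega>)))"

text \<open>A Levy subordinator. Stochastic continuity is not listed, since it follows from
  right-continuity together with stationarity of the increments.\<close>

definition subordinator :: "'a measure \<Rightarrow> (real \<Rightarrow> 'a \<Rightarrow> real) \<Rightarrow> bool" where
  "subordinator M D \<longleftrightarrow>
     (\<forall>t\<ge>0. D t \<in> borel_measurable M) \<and>
     (AE \<omega> in M. D 0 \<omega> = 0) \<and>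
     indep_increments M D \<and> stationary_increments M D \<and> increasing_cadlag_paths M D"

definition subordinator_with_exponent ::
  "'a measure \<Rightarrow> (real \<Rightarrow> real) \<Rightarrow> (real \<Rightarrow> 'a \<Rightarrow> real) \<Rightarrow> bool" where
  "subordinator_with_exponent M f D \<longleftrightarrow>
     subordinator M D \<and>
     (\<forall>t\<ge>0. \<forall>s>0. (\<integral>\<omega>. exp (- s * D t \<omega>) \<partial>M) = exp (- t * f s))"

text \<open>First passage time of \<open>D\<close> above level \<open>t\<close>. For the subordinators considered here the level is
  almost surely exceeded; on the exceptional null set the value is fixed to be \<open>0\<close>, because
  \<open>Inf {}\<close> is unspecified on the reals (and possibly negative).\<close>

definition inverse_process :: "(real \<Rightarrow> 'a \<Rightarrow> real) \<Rightarrow> real \<Rightarrow> 'a \<Rightarrow> real" where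
  "inverse_process D t \<omega> =
     (let R = {r. 0 \<le> r \<and> D r \<omega> > t} in if R = {} then 0 else Inf R)"

definition poisson_process :: "'a measure \<Rightarrow> real \<Rightarrow> (real \<Rightarrow> 'a \<Rightarrow> nat) \<Rightarrow> bool" where
  "poisson_process M lam N \<longleftrightarrow>
     (\<forall>t\<ge>0. N t \<in> measurable M (count_space UNIV)) \<and>
     (AE \<omega> in M. N 0 \<omega> = 0) \<and>
     indep_increments M (\<lambda>t \<omega>. real (N t \<omega>)) \<and>
     increasing_cadlag_paths M (\<lambda>t \<omega>. real (N t \<omega>)) \<and>
     (\<forall>s t. 0 \<le> s \<and> s < t \<longrightarrow>
        distr M (count_space UNIV) (\<lambda>\<omega>. N t \<omega> - N s \<omega>) = measure_pmf (poisson_pmf (lam * (t - s))))"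

definition time_change :: "(real \<Rightarrow> 'a \<Rightarrow> 'b) \<Rightarrow> (real \<Rightarrow> 'a \<Rightarrow> real) \<Rightarrow> real \<Rightarrow> 'a \<Rightarrow> 'b" where
  "time_change N E t \<omega> = N (E t \<omega>) \<omega>"

text \<open>The jumps are \<open>X 1, X 2, \<dots>\<close>; the value \<open>X 0\<close> is never used.\<close>

definition compound_process ::
  "(nat \<Rightarrow> 'a \<Rightarrow> real) \<Rightarrow> (real \<Rightarrow> 'a \<Rightarrow> nat) \<Rightarrow> real \<Rightarrow> 'a \<Rightarrow> real" where
  "compound_process X A t \<omega> = (\<Sum>i=1..A t \<omega>. X i \<omega>)"

definition iid_with_law :: "'a measure \<Rightarrow> real measure \<Rightarrow> (nat \<Rightarrow> 'a \<Rightarrow> real) \<Rightarrow> bool" where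
  "iid_with_law M FX X \<longleftrightarrow>
     prob_space.indep_vars M (\<lambda>_. borel) X {1..} \<and> (\<forall>i\<ge>1. distr M borel (X i) = FX)"

definition generated_sigma ::
  "'a measure \<Rightarrow> 'i set \<Rightarrow> 'b measure \<Rightarrow> ('i \<Rightarrow> 'a \<Rightarrow> 'b) \<Rightarrow> 'a measure" where
  "generated_sigma M I S Z =
     sigma (space M) (\<Union>i\<in>I. {Z i -` A \<inter> space M | A. A \<in> sets S})"

definition indep_families ::
  "'a measure \<Rightarrow> 'i set \<Rightarrow> 'b measure \<Rightarrow> ('i \<Rightarrow> 'a \<Rightarrow> 'b) \<Rightarrow>
   'j set \<Rightarrow> 'c measure \<Rightarrow> ('j \<Rightarrow> 'a \<Rightarrow> 'c) \<Rightarrow> bool" where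
  "indep_families M I S Z J T W \<longleftrightarrow>
     prob_space.indep_set M (sets (generated_sigma M I S Z)) (sets (generated_sigma M J T W))"

definition natural_filtration ::
  "'a measure \<Rightarrow> 'b measure \<Rightarrow> (real \<Rightarrow> 'a \<Rightarrow> 'b) \<Rightarrow> real \<Rightarrow> 'a measure" where
  "natural_filtration M S Z t = generated_sigma M {0..t} S Z"

definition join_filtration ::
  "'a measure \<Rightarrow> (real \<Rightarrow> 'a measure) \<Rightarrow> (real \<Rightarrow> 'a measure) \<Rightarrow> real \<Rightarrow> 'a measure" where
  "join_filtration M F G t = sigma (space M) (sets (F t) \<union> sets (G t))"

definition martingale :: "'a measure \<Rightarrow> (real \<Rightarrow> 'a measure) \<Rightarrow> (real \<Rightarrow> 'a \<Rightarrow> real) \<Rightarrow> bool" where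
  "martingale M F Z \<longleftrightarrow>
     (\<forall>t\<ge>0. subalgebra M (F t)) \<and>
     (\<forall>s t. 0 \<le> s \<and> s \<le> t \<longrightarrow> subalgebra (F t) (F s)) \<and>
     (\<forall>t\<ge>0. Z t \<in> borel_measurable (F t)) \<and>
     (\<forall>t\<ge>0. integrable M (Z t)) \<and>
     (\<forall>s t. 0 \<le> s \<and> s \<le> t \<longrightarrow> (AE \<omega> in M. real_cond_exp M (F s) (Z t) \<omega> = Z s \<omega>))"

end

(* Conditionally on the past, the number of jumps of a time-changed Poisson process in (s, t] has
   mean lambda times the increment of the clock, because E(s) is a stopping time for the filtration
   generated by N and the whole path of E, and N(r) - lambda r stays a martingale when the
   independent path of E is added to the past.  The clock is approximated from above by grid values,
   so that N(E(t)) - N(E(s)) becomes a sum of grid increments, each independent of the event that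
   selects it, and right continuity removes the grid.  In the same way Y(t) - Y(s) is the sum of the
   X(i) with N_f(s) < i <= N_f(t), and X(i) is independent of the first i - 1 jumps and of the pair
   (N_f, E), which determine the event selecting it.  Integrability of E(t) comes from
   P(E(t) > n) <= P(D(n) <= t) <= exp(t - n f(1)) with f(1) > 0. *)

theory Submission
  imports Defs
begin

section \<open>Generated sigma-algebras and independence\<close>

text \<open>The increment of \<open>Mf\<close> splits into Y(t) - Y(s) - mu (N_f(t) - N_f(s)) and mu
  (N_f(t) - N_f(s) - lambda (E(t) - E(s))), where mu is the mean of X(1). Both parts are integrated
  over an event C of the past by Wald-type sums, so the real task is to show that C is admissible: C
  cut by E(s) < r must be known from N up to r and the clock, and C cut by N_f(s) <= n from the
  first n jumps and the pair (N_f, E). This is why stopped sigma-algebras are encoded through traces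
  (\<open>trace_sigma\<close>), where membership can be checked on generators. Traces are compared
  modulo null sets because the clock is monotone only almost surely: where a path of D never exceeds
  a level, E takes its default value 0. Past events that also involve Y are handled in the second
  part by the independence of the jumps from (N_f, E). Infinite mass of the Levy measure enters only
  through f(1) > 0, which makes a geometric series converge.\<close>

lemma space_generated_sigma [simp]: "space (generated_sigma M I S Z) = space M"
  by (simp add: generated_sigma_def space_measure_of_conv)

lemma sets_generated_sigma:
  "sets (generated_sigma M I S Z) =
     sigma_sets (space M) (\<Union>i\<in>I. {Z i -` A \<inter> space M | A. A \<in> sets S})"
  unfolding generated_sigma_def by (rule sets_measure_of) auto

lemma sets_generated_sigma_subset:
  assumes "\<And>i. i \<in> I \<Longrightarrow> Z i \<in> K \<rightarrow>\<^sub>M S" and "space K = space M"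
  shows "sets (generated_sigma M I S Z) \<subseteq> sets K"
  unfolding sets_generated_sigma assms(2)[symmetric]
  by (rule sets.sigma_sets_subset) (use assms(1) in \<open>auto dest!: measurable_sets\<close>)

lemma measurable_generated_sigma:
  assumes "i \<in> I" and "Z i \<in> space M \<rightarrow> space S"
  shows "Z i \<in> generated_sigma M I S Z \<rightarrow>\<^sub>M S"
proof (rule measurableI)
  fix A assume "A \<in> sets S"
  then show "Z i -` A \<inter> space (generated_sigma M I S Z) \<in> sets (generated_sigma M I S Z)"
    unfolding sets_generated_sigma using assms(1)
    by (intro sigma_sets.Basic) auto
qed (use assms in auto)

section \<open>Joins of sigma-algebras and independence\<close>

definition join_sigma :: "'a measure \<Rightarrow> 'a measure \<Rightarrow> 'a measure \<Rightarrow> 'a measure" where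
  "join_sigma M A B = sigma (space M) (sets A \<union> sets B)"

lemma join_filtration_eq: "join_filtration M F G t = join_sigma M (F t) (G t)"
  by (simp add: join_filtration_def join_sigma_def)

lemma space_join_sigma [simp]: "space (join_sigma M A B) = space M"
  by (simp add: join_sigma_def space_measure_of_conv)

lemma sets_join_sigma:
  assumes "space A = space M" and "space B = space M"
  shows "sets (join_sigma M A B) = sigma_sets (space M) (sets A \<union> sets B)"
  unfolding join_sigma_def
  using sets.space_closed[of A] sets.space_closed[of B] assms by (intro sets_measure_of) auto

lemma sets_join_sigma_subset:
  assumes "space A = space M" "space B = space M" "space K = space M"
    and "sets A \<subseteq> sets K" "sets B \<subseteq> sets K"
  shows "sets (join_sigma M A B) \<subseteq> sets K"
  unfolding sets_join_sigma[OF assms(1,2)] assms(3)[symmetric]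
  by (rule sets.sigma_sets_subset) (use assms in auto)

lemma sets_join_sigma1: "space A = space M \<Longrightarrow> space B = space M \<Longrightarrow> sets A \<subseteq> sets (join_sigma M A B)"
  and sets_join_sigma2: "space A = space M \<Longrightarrow> space B = space M \<Longrightarrow> sets B \<subseteq> sets (join_sigma M A B)"
  by (auto simp: sets_join_sigma)

lemma measurable_mono_sets:
  assumes "f \<in> A \<rightarrow>\<^sub>M S" "sets A \<subseteq> sets B" "space A = space B"
  shows "f \<in> B \<rightarrow>\<^sub>M S"
  using assms unfolding measurable_def by auto

text \<open>A union of two sigma-algebras is in general not closed under intersection. The sets a
  \<inter> b are, so Dynkin arguments about a join start from this generator.\<close>

lemma sets_join_sigma_Int:
  assumes [simp]: "space A = space M" "space B = space M"
  shows "sets (join_sigma M A B) = sigma_sets (space M) {a \<inter> b | a b. a \<in> sets A \<and> b \<in> sets B}"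
    (is "_ = sigma_sets _ ?G")
proof
  have "sets A \<union> sets B \<subseteq> sigma_sets (space M) ?G"
  proof safe
    fix a assume "a \<in> sets A"
    then have "a = a \<inter> space M" using sets.sets_into_space[of a A] by auto
    then show "a \<in> sigma_sets (space M) ?G"
      using \<open>a \<in> sets A\<close> sets.top[of B] by (intro sigma_sets.Basic) auto
  next
    fix a assume "a \<in> sets B"
    then have "a = space M \<inter> a" using sets.sets_into_space[of a B] by auto
    then show "a \<in> sigma_sets (space M) ?G"
      using \<open>a \<in> sets B\<close> sets.top[of A] by (intro sigma_sets.Basic) auto
  qed
  then show "sets (join_sigma M A B) \<subseteq> sigma_sets (space M) ?G"
    by (simp add: sets_join_sigma sigma_sets_mono)
  have "?G \<subseteq> sets (join_sigma M A B)"
    using sets_join_sigma1[of A M B] sets_join_sigma2[of A M B] by auto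
  then show "sigma_sets (space M) ?G \<subseteq> sets (join_sigma M A B)"
    using sets.sigma_sets_subset[of ?G "join_sigma M A B"] by simp
qed

lemma Int_stable_sets_Int:
  "Int_stable {a \<inter> b | a b. a \<in> sets A \<and> b \<in> sets B}"
proof (rule Int_stableI, safe)
  fix a b a' b' assume *: "a \<in> sets A" "b \<in> sets B" "a' \<in> sets A" "b' \<in> sets B"
  have "a \<inter> b \<inter> (a' \<inter> b') = (a \<inter> a') \<inter> (b \<inter> b')" by auto
  then show "\<exists>c d. a \<inter> b \<inter> (a' \<inter> b') = c \<inter> d \<and> c \<in> sets A \<and> d \<in> sets B"
    using * by blast
qed

text \<open>Pairwise independence of the three sigma-algebras would not do. Since A and B lie in a
  common S independent of H, the product P(a b h) = P(a b) P(h) = P(a) P(b) P(h) factors completely.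
  In the applications S carries a whole process (N or the jumps), A its next increment or jump, B
  its past, and H the independent information added to that past.\<close>

lemma (in prob_space) indep_set_join_sigma:
  assumes AB: "indep_set (sets A) (sets B)" and SH: "indep_set (sets S) (sets H)"
    and sub: "sets A \<subseteq> sets S" "sets B \<subseteq> sets S"
    and sp: "space A = space M" "space B = space M" "space H = space M"
  shows "indep_set (sets A) (sets (join_sigma M B H))"
proof -
  let ?G = "{b \<inter> h | b h. b \<in> sets B \<and> h \<in> sets H}"
  have ev: "sets A \<subseteq> events" "sets B \<subseteq> events" "sets H \<subseteq> events"
    using AB SH by (auto simp: indep_sets2_eq)
  have "indep_set (sets A) ?G"
  proof (rule indep_setI)
    fix a g assume "a \<in> sets A" "g \<in> ?G"
    then obtain b h where *: "a \<in> sets A" "b \<in> sets B" "h \<in> sets H" and g: "g = b \<inter> h" by auto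
    then have **: "a \<in> sets S" "b \<in> sets S" using sub by auto
    have "prob (a \<inter> g) = prob ((a \<inter> b) \<inter> h)" by (simp add: g Int_assoc)
    also have "\<dots> = prob (a \<inter> b) * prob h"
      using indep_setD[OF SH, of "a \<inter> b" h] * ** by auto
    also have "\<dots> = prob a * (prob b * prob h)"
      using indep_setD[OF AB] * by simp
    also have "prob b * prob h = prob g"
      using indep_setD[OF SH, of b h] * ** by (simp add: g)
    finally show "prob (a \<inter> g) = prob a * prob g" .
  qed (use ev in auto)
  moreover have "Int_stable (sets A)" by (rule sets.Int_stable)
  ultimately have "indep_set (sigma_sets (space M) (sets A)) (sigma_sets (space M) ?G)"
    by (rule indep_set_sigma_sets) (rule Int_stable_sets_Int)
  then show ?thesis
    using sets.sigma_sets_eq[of A] by (simp add: sets_join_sigma_Int sp)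
qed

lemma (in prob_space) indep_set_integral_mult:
  fixes f g :: "'a \<Rightarrow> real"
  assumes AB: "indep_set (sets A) (sets B)" and sp: "space A = space M" "space B = space M"
    and f: "f \<in> borel_measurable A" "integrable M f"
    and g: "g \<in> borel_measurable B" "integrable M g"
  shows "integrable M (\<lambda>\<omega>. f \<omega> * g \<omega>)"
    and "(\<integral>\<omega>. f \<omega> * g \<omega> \<partial>M) = (\<integral>\<omega>. f \<omega> \<partial>M) * (\<integral>\<omega>. g \<omega> \<partial>M)"
proof -
  have *: "sigma_sets (space M) {f -` S \<inter> space M |S. S \<in> sets borel} \<subseteq> sets A"
    using sets.sigma_sets_subset[of "{f -` S \<inter> space M |S. S \<in> sets borel}" A] measurable_sets[OF f(1)] sp
    by auto
  have **: "sigma_sets (space M) {g -` S \<inter> space M |S. S \<in> sets borel} \<subseteq> sets B"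
    using sets.sigma_sets_subset[of "{g -` S \<inter> space M |S. S \<in> sets borel}" B] measurable_sets[OF g(1)] sp
    by auto
  have "indep_var borel f borel g"
    unfolding indep_var_eq
  proof (intro conjI)
    show "indep_set (sigma_sets (space M) {f -` S \<inter> space M |S. S \<in> sets borel})
       (sigma_sets (space M) {g -` S \<inter> space M |S. S \<in> sets borel})"
      using indep_setD[OF AB] AB[unfolded indep_sets2_eq] * **
      by (intro indep_setI) (meson subset_iff)+
  qed (use f(2) g(2) in auto)
  from indep_var_integrable[OF this f(2) g(2)] indep_var_lebesgue_integral[OF this f(2) g(2)]
  show "integrable M (\<lambda>\<omega>. f \<omega> * g \<omega>)"
    and "(\<integral>\<omega>. f \<omega> * g \<omega> \<partial>M) = (\<integral>\<omega>. f \<omega> \<partial>M) * (\<integral>\<omega>. g \<omega> \<partial>M)" by auto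
qed

section \<open>Traces of sigma-algebras on an event, modulo null sets\<close>

text \<open>Agreement on \<open>T\<close> is only required almost surely: the clock and the counting processes are
  monotone in time only outside a null set.\<close>

definition trace_sigma :: "'a measure \<Rightarrow> 'a measure \<Rightarrow> 'a set \<Rightarrow> 'a measure" where
  "trace_sigma M G T = sigma (space M)
     {C \<in> sets M. \<exists>C'\<in>sets G. AE \<omega> in M. (\<omega> \<in> C \<and> \<omega> \<in> T) \<longleftrightarrow> \<omega> \<in> C'}"

lemma space_trace_sigma [simp]: "space (trace_sigma M G T) = space M"
  by (simp add: trace_sigma_def space_measure_of_conv)

text \<open>The family is already a sigma-algebra because T belongs to G: the complement of C has
  trace T - C'. With T = {\<sigma> < r} and G the information at time r, membership for all r is the
  usual description of the sigma-algebra of a stopping time.\<close>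

lemma sets_trace_sigma:
  assumes T: "T \<in> sets G" and sp: "space G = space M"
  shows "sets (trace_sigma M G T) =
    {C \<in> sets M. \<exists>C'\<in>sets G. AE \<omega> in M. (\<omega> \<in> C \<and> \<omega> \<in> T) \<longleftrightarrow> \<omega> \<in> C'}" (is "_ = ?S")
proof -
  have "sigma_algebra (space M) ?S"
    unfolding sigma_algebra_iff2
  proof (intro conjI ballI allI impI)
    show "?S \<subseteq> Pow (space M)" using sets.space_closed by auto
    show "{} \<in> ?S" by (auto intro!: bexI[of _ "{}"])
  next
    fix C assume "C \<in> ?S"
    then obtain C' where C: "C \<in> sets M" "C' \<in> sets G" "AE \<omega> in M. (\<omega> \<in> C \<and> \<omega> \<in> T) \<longleftrightarrow> \<omega> \<in> C'"
      by auto
    have "AE \<omega> in M. (\<omega> \<in> space M - C \<and> \<omega> \<in> T) \<longleftrightarrow> \<omega> \<in> T - C'"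
      using C(3) AE_space by eventually_elim auto
    then show "space M - C \<in> ?S" using C T by (auto intro!: bexI[of _ "T - C'"])
  next
    fix A :: "nat \<Rightarrow> 'a set" assume "range A \<subseteq> ?S"
    then have "\<forall>i. \<exists>C'\<in>sets G. AE \<omega> in M. (\<omega> \<in> A i \<and> \<omega> \<in> T) \<longleftrightarrow> \<omega> \<in> C'" and A: "range A \<subseteq> sets M"
      by auto
    then obtain B where B: "\<And>i. B i \<in> sets G"
      and AB: "\<And>i. AE \<omega> in M. (\<omega> \<in> A i \<and> \<omega> \<in> T) \<longleftrightarrow> \<omega> \<in> B i"
      by metis
    have "AE \<omega> in M. \<forall>i. (\<omega> \<in> A i \<and> \<omega> \<in> T) \<longleftrightarrow> \<omega> \<in> B i"
      using AB by (simp add: AE_all_countable)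
    then have "AE \<omega> in M. (\<omega> \<in> (\<Union>i. A i) \<and> \<omega> \<in> T) \<longleftrightarrow> \<omega> \<in> (\<Union>i. B i)"
      by eventually_elim auto
    then show "(\<Union>i. A i) \<in> ?S" using A B by (auto intro!: bexI[of _ "\<Union>i. B i"])
  qed
  then show ?thesis unfolding trace_sigma_def by (simp add: sigma_algebra.sets_measure_of_eq)
qed

lemma sets_trace_sigma_subset: "sets (trace_sigma M G T) \<subseteq> sets M"
proof -
  let ?S = "{C \<in> sets M. \<exists>C'\<in>sets G. AE \<omega> in M. (\<omega> \<in> C \<and> \<omega> \<in> T) \<longleftrightarrow> \<omega> \<in> C'}"
  have "?S \<subseteq> Pow (space M)" using sets.space_closed by auto
  then have "sets (trace_sigma M G T) = sigma_sets (space M) ?S"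
    unfolding trace_sigma_def by (rule sets_measure_of)
  also have "\<dots> \<subseteq> sets M" by (rule sets.sigma_sets_subset) auto
  finally show ?thesis .
qed

text \<open>A function need only coincide on T with a G-measurable one. The witness g will be the
  same quantity stopped at a deterministic time or truncated after a fixed number of jumps.\<close>

lemma measurable_trace_sigma:
  assumes T: "T \<in> sets G" and sp: "space G = space M"
    and f: "f \<in> M \<rightarrow>\<^sub>M S" and g: "g \<in> G \<rightarrow>\<^sub>M S"
    and eq: "AE \<omega> in M. \<omega> \<in> T \<longrightarrow> f \<omega> = g \<omega>"
  shows "f \<in> trace_sigma M G T \<rightarrow>\<^sub>M S"
proof (rule measurableI)
  fix A assume A: "A \<in> sets S"
  have "AE \<omega> in M. (\<omega> \<in> f -` A \<inter> space M \<and> \<omega> \<in> T) \<longleftrightarrow> \<omega> \<in> (g -` A \<inter> space G) \<inter> T"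
    using eq AE_space by eventually_elim (auto simp: sp)
  then show "f -` A \<inter> space (trace_sigma M G T) \<in> sets (trace_sigma M G T)"
    using measurable_sets[OF f A] measurable_sets[OF g A] T
    unfolding sets_trace_sigma[OF T sp] by (auto intro!: bexI[of _ "(g -` A \<inter> space G) \<inter> T"])
qed (use measurable_space[OF f] in auto)

section \<open>Independence of increments from the past\<close>

lemma (in prob_space) indep_set_mono:
  assumes "indep_set A B" "A' \<subseteq> A" "B' \<subseteq> B"
  shows "indep_set A' B'"
proof (rule indep_setI)
  show "A' \<subseteq> events" "B' \<subseteq> events"
    using assms unfolding indep_sets2_eq by (meson order_trans)+
  show "prob (a \<inter> b) = prob a * prob b" if "a \<in> A'" "b \<in> B'" for a b
    using that assms by (intro indep_setD[of A B]) auto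
qed

lemma (in prob_space) indep_vars_generated_sigma:
  assumes X: "indep_vars (\<lambda>_. S) X I" and AB: "A \<subseteq> I" "B \<subseteq> I" "A \<inter> B = {}"
  shows "indep_set (sets (generated_sigma M A S X)) (sets (generated_sigma M B S X))"
proof -
  let ?E = "\<lambda>i. {X i -` A \<inter> space M | A. A \<in> sets S}"
  have "indep_sets ?E I" using X unfolding indep_vars_def2 by (rule conjunct2)
  then have "indep_sets ?E (\<Union>j\<in>UNIV. case_bool A B j)"
    by (rule indep_sets_mono_index[rotated]) (use AB in \<open>simp add: UNIV_bool\<close>)
  moreover have "Int_stable (?E i)" for i
  proof (rule Int_stableI, safe)
    fix C D assume "C \<in> sets S" "D \<in> sets S"
    then show "\<exists>Aa. X i -` C \<inter> space M \<inter> (X i -` D \<inter> space M) = X i -` Aa \<inter> space M \<and> Aa \<in> sets S"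
      by (intro exI[of _ "C \<inter> D"]) auto
  qed
  moreover have "disjoint_family_on (case_bool A B) UNIV"
    using AB by (auto simp: disjoint_family_on_def UNIV_bool)
  ultimately have "indep_sets (\<lambda>j. sigma_sets (space M) (\<Union>i\<in>case_bool A B j. ?E i)) UNIV"
    by (intro indep_sets_collect_sigma) auto
  then show ?thesis
    unfolding indep_set_def sets_generated_sigma
    by (rule indep_sets_mono_sets) (simp split: bool.splits)
qed

text \<open>The definition speaks only of finitely many consecutive increments. For finitely many
  past times, the past values are partial sums of increments preceding the last one; a Dynkin
  argument then reaches all times up to s. Values are taken relative to Z(0), which increments do
  not determine.\<close>

lemma (in prob_space) indep_increments_past:
  assumes inc: "indep_increments M Z" and st: "0 \<le> s" "s \<le> t"
  shows "indep_set (sets (generated_sigma M {()} borel (\<lambda>_ \<omega>. Z t \<omega> - Z s \<omega>)))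
                   (sets (generated_sigma M {0..s} borel (\<lambda>u \<omega>. Z u \<omega> - Z 0 \<omega>)))"
proof -
  let ?A = "generated_sigma M {()} borel (\<lambda>_ \<omega>. Z t \<omega> - Z s \<omega>)"
  let ?S = "\<lambda>J. generated_sigma M J borel (\<lambda>u \<omega>. Z u \<omega> - Z 0 \<omega>)"
  have fin: "indep_set (sets ?A) (sets (?S J))" if J: "finite J" "J \<subseteq> {0..s}" for J
  proof -
    \<comment> \<open>Adding 0 and s to the times makes the chain start at 0 and reach s at index k.
      The next node is t, so the increment with index k is exactly Z(t) - Z(s).\<close>
    define L where "L = sorted_list_of_set (insert 0 (insert s J))"
    define k where "k = length L - 1"
    have setL: "set L = insert 0 (insert s J)" and srt: "sorted L"
      using J by (simp_all add: L_def del: sorted_list_of_set_insert_remove)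
    have lenL: "length L = Suc k" using setL by (cases L) (auto simp: k_def)
    have in01: "0 \<le> x" "x \<le> s" if "x \<in> set L" for x using that setL st J by auto
    have L0: "L ! 0 = 0"
    proof -
      obtain i where "i < length L" "L ! i = 0" using setL by (metis in_set_conv_nth insertI1)
      then have "L ! 0 \<le> 0" using sorted_nth_mono[OF srt, of 0 i] by auto
      then show ?thesis using in01(1)[of "L ! 0"] lenL by auto
    qed
    have Lk: "L ! k = s"
    proof -
      obtain i where "i < length L" "L ! i = s" using setL by (metis in_set_conv_nth insertI1 insertI2)
      then have "s \<le> L ! k" using sorted_nth_mono[OF srt, of i k] lenL by auto
      then show ?thesis using in01(2)[of "L ! k"] lenL by auto
    qed
    define \<tau> where "\<tau> i = (if i \<le> k then L ! i else t)" for i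
    define \<Delta> where "\<Delta> i \<omega> = Z (\<tau> (Suc i)) \<omega> - Z (\<tau> i) \<omega>" for i \<omega>
    have mono: "\<tau> i \<le> \<tau> (Suc i)" if "i < Suc k" for i
      using that sorted_nth_mono[OF srt, of i "Suc i"] lenL Lk st
      by (cases "i = k") (auto simp: \<tau>_def)
    have "indep_vars (\<lambda>_. borel) \<Delta> {..<Suc k}"
      using inc[unfolded indep_increments_def, rule_format, of \<tau> "Suc k"] mono
      by (simp add: \<Delta>_def[abs_def] \<tau>_def L0)
    then have ind: "indep_set (sets (generated_sigma M {k} borel \<Delta>)) (sets (generated_sigma M {..<k} borel \<Delta>))"
      by (rule indep_vars_generated_sigma) auto
    show ?thesis
    proof (rule indep_set_mono[OF ind])
      have "\<Delta> k \<in> borel_measurable (generated_sigma M {k} borel \<Delta>)"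
        by (rule measurable_generated_sigma) auto
      then show "sets ?A \<subseteq> sets (generated_sigma M {k} borel \<Delta>)"
        by (intro sets_generated_sigma_subset) (auto simp: \<Delta>_def[abs_def] \<tau>_def Lk)
      show "sets (?S J) \<subseteq> sets (generated_sigma M {..<k} borel \<Delta>)"
      proof (rule sets_generated_sigma_subset)
        fix u assume "u \<in> J"
        then obtain p where p: "p \<le> k" "L ! p = u" using setL lenL by (metis in_set_conv_nth insertI2 less_Suc_eq_le)
        have "(\<Sum>i<p. \<Delta> i \<omega>) = Z u \<omega> - Z 0 \<omega>" for \<omega>
          using sum_lessThan_telescope[of "\<lambda>i. Z (\<tau> i) \<omega>" p] p L0 by (simp add: \<Delta>_def \<tau>_def)
        moreover have "(\<lambda>\<omega>. \<Sum>i<p. \<Delta> i \<omega>) \<in> borel_measurable (generated_sigma M {..<k} borel \<Delta>)"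
          using p by (intro borel_measurable_sum measurable_generated_sigma) auto
        ultimately show "(\<lambda>\<omega>. Z u \<omega> - Z 0 \<omega>) \<in> borel_measurable (generated_sigma M {..<k} borel \<Delta>)"
          by simp
      qed simp
    qed
  qed
  \<comment> \<open>Finite time sets are directed under union, so this union of sigma-algebras is
    closed under intersection without being a sigma-algebra itself.\<close>
  let ?G = "\<Union>J\<in>{J. finite J \<and> J \<subseteq> {0..s}}. sets (?S J)"
  have mono: "sets (?S J) \<subseteq> sets (?S J')" if "J \<subseteq> J'" for J J'
    using that by (intro sets_generated_sigma_subset measurable_generated_sigma) auto
  have "Int_stable ?G"
  proof (rule Int_stableI)
    fix a b assume "a \<in> ?G" "b \<in> ?G"
    then obtain J K where J: "finite J" "J \<subseteq> {0..s}" "a \<in> sets (?S J)"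
      and K: "finite K" "K \<subseteq> {0..s}" "b \<in> sets (?S K)" by auto
    have "a \<in> sets (?S (J \<union> K))" "b \<in> sets (?S (J \<union> K))"
      using J(3) K(3) mono[of J "J \<union> K"] mono[of K "J \<union> K"] by auto
    then have "a \<inter> b \<in> sets (?S (J \<union> K))" by auto
    then show "a \<inter> b \<in> ?G" using J K by (intro UN_I[of "J \<union> K"]) auto
  qed
  moreover have "indep_set (sets ?A) ?G"
  proof (rule indep_setI)
    show "sets ?A \<subseteq> events"
      using fin[of "{}"] by (simp add: indep_sets2_eq)
    show "?G \<subseteq> events"
      using fin by (auto simp: indep_sets2_eq)
    show "prob (a \<inter> b) = prob a * prob b" if "a \<in> sets ?A" "b \<in> ?G" for a b
      using that indep_setD[OF fin] by auto
  qed
  ultimately have "indep_set (sigma_sets (space M) (sets ?A)) (sigma_sets (space M) ?G)"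
    by (intro indep_set_sigma_sets sets.Int_stable)
  moreover have "sets (?S {0..s}) \<subseteq> sigma_sets (space M) ?G"
    unfolding sets_generated_sigma[of M "{0..s}"]
  proof (rule sigma_sets_mono, safe)
    fix u and A :: "real set" assume u: "u \<in> {0..s}" "A \<in> sets borel"
    have "(\<lambda>\<omega>. Z u \<omega> - Z 0 \<omega>) -` A \<inter> space M \<in> sets (?S {u})"
      unfolding sets_generated_sigma using u by (intro sigma_sets.Basic) auto
    then show "(\<lambda>\<omega>. Z u \<omega> - Z 0 \<omega>) -` A \<inter> space M \<in> sigma_sets (space M) ?G"
      using u by (intro sigma_sets.Basic UN_I[of "{u}"]) auto
  qed
  ultimately show ?thesis
    using sets.sigma_sets_eq[of ?A] by (auto intro: indep_set_mono)
qed

section \<open>Discretisation of random times from above\<close>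

text \<open>The grid point \<open>grid n x\<close> lies strictly above \<open>x \<ge> 0\<close>, so right continuity is all that is
  needed to pass to the limit; \<open>grid 0\<close> dominates every other grid and yields the majorant.\<close>

definition grid_index :: "nat \<Rightarrow> real \<Rightarrow> nat" where
  "grid_index n x = Suc (nat \<lfloor>x * real (Suc n)\<rfloor>)"

definition grid :: "nat \<Rightarrow> real \<Rightarrow> real" where
  "grid n x = real (grid_index n x) / real (Suc n)"

text \<open>Turns the cell condition \<open>grid_index n \<sigma> \<le> j\<close> and
  \<open>j < grid_index n \<tau>\<close> into \<sigma> < j/(n+1) \<le> \<tau>, an event that can be
  decided at time j/(n+1).\<close>

lemma grid_index_le_iff:
  assumes "0 \<le> x"
  shows "grid_index n x \<le> j \<longleftrightarrow> x < real j / real (Suc n)"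
proof -
  have "grid_index n x \<le> j \<longleftrightarrow> \<lfloor>x * real (Suc n)\<rfloor> < int j"
    using assms by (simp add: grid_index_def Suc_le_eq nat_less_iff)
  also have "\<dots> \<longleftrightarrow> x * real (Suc n) < real j" by (simp add: floor_less_iff)
  finally show ?thesis by (simp add: pos_less_divide_eq)
qed

lemma grid_greater: "0 \<le> x \<Longrightarrow> x < grid n x"
  using grid_index_le_iff[of x n "grid_index n x"] by (simp add: grid_def)

lemma grid_le:
  assumes "0 \<le> x" shows "grid n x \<le> x + 1 / real (Suc n)"
proof -
  have "real (grid_index n x) \<le> x * real (Suc n) + 1"
    using assms of_int_floor_le[of "x * real (Suc n)"] by (simp add: grid_index_def)
  then have "grid n x \<le> (x * real (Suc n) + 1) / real (Suc n)"
    unfolding grid_def by (intro divide_right_mono) auto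
  then show ?thesis by (simp add: field_simps)
qed

text \<open>The integer \<open>grid 0 x\<close> lies strictly above x and is also a point of the
  n-th grid, whose least point strictly above x is \<open>grid n x\<close>.\<close>

lemma grid_le_grid_0:
  assumes "0 \<le> x" shows "grid n x \<le> grid 0 x"
proof -
  have "grid_index n x \<le> grid_index 0 x * Suc n"
    using grid_greater[OF assms, of 0]
    unfolding grid_index_le_iff[OF assms] by (simp add: grid_def del: of_nat_Suc mult_Suc_right)
  then have "real (grid_index n x) \<le> real (grid_index 0 x * Suc n)" by (rule of_nat_mono)
  then show ?thesis by (simp add: grid_def field_simps)
qed

lemma grid_nonneg [simp]: "0 \<le> grid n x"
  by (simp add: grid_def)

lemma measurable_grid_index [measurable]: "grid_index n \<in> borel \<rightarrow>\<^sub>M count_space UNIV"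
  unfolding grid_index_def[abs_def] by measurable

lemma tendsto_grid_at_right:
  assumes "0 \<le> x" shows "filterlim (\<lambda>n. grid n x) (at_right x) sequentially"
proof -
  have "(\<lambda>n. x + 1 / real (Suc n)) \<longlonglongrightarrow> x + 0"
    by (rule tendsto_add[OF tendsto_const LIMSEQ_Suc[OF lim_1_over_n]])
  then have lim: "(\<lambda>n. x + 1 / real (Suc n)) \<longlonglongrightarrow> x" by (simp only: add_0_right)
  have "(\<lambda>n. grid n x) \<longlonglongrightarrow> x"
  proof (rule tendsto_sandwich[OF _ _ tendsto_const lim])
    show "\<forall>\<^sub>F n in sequentially. x \<le> grid n x"
      by (rule always_eventually) (use grid_greater[OF assms] in \<open>blast intro: less_imp_le\<close>)
    show "\<forall>\<^sub>F n in sequentially. grid n x \<le> x + 1 / real (Suc n)"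
      by (rule always_eventually) (use grid_le[OF assms] in blast)
  qed
  then show ?thesis
    using grid_greater[OF assms] unfolding filterlim_at
    by (simp add: less_imp_neq[THEN not_sym])
qed

lemma right_continuous_grid:
  assumes "0 \<le> x" "continuous (at_right x) f"
  shows "(\<lambda>n. f (grid n x)) \<longlonglongrightarrow> (f x :: real)"
  using filterlim_compose[OF assms(2)[unfolded continuous_within] tendsto_grid_at_right[OF assms(1)]] .

lemma measurable_grid_time:
  assumes Z: "\<And>u. 0 \<le> u \<Longrightarrow> Z u \<in> A \<rightarrow>\<^sub>M S" and T: "T \<in> borel_measurable A"
  shows "(\<lambda>\<omega>. Z (grid n (T \<omega>)) \<omega>) \<in> A \<rightarrow>\<^sub>M S"
  unfolding grid_def
  by (rule measurable_compose_countable[where f="\<lambda>i. Z (real i / real (Suc n))"])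
     (use T in \<open>auto intro!: Z\<close>)

text \<open>The time on the grid takes countably many values, which settles measurability there;
  right continuity of the paths transfers it to T.\<close>

lemma measurable_random_time:
  fixes Z :: "real \<Rightarrow> 'a \<Rightarrow> real"
  assumes Z: "\<And>u. 0 \<le> u \<Longrightarrow> Z u \<in> borel_measurable A" and T: "T \<in> borel_measurable A"
    and nn: "\<And>\<omega>. \<omega> \<in> space A \<Longrightarrow> 0 \<le> T \<omega>"
    and rc: "\<And>\<omega> u. \<omega> \<in> space A \<Longrightarrow> 0 \<le> u \<Longrightarrow> continuous (at_right u) (\<lambda>u. Z u \<omega>)"
  shows "(\<lambda>\<omega>. Z (T \<omega>) \<omega>) \<in> borel_measurable A"
proof (rule borel_measurable_LIMSEQ_real)
  show "(\<lambda>n. Z (grid n (T \<omega>)) \<omega>) \<longlonglongrightarrow> Z (T \<omega>) \<omega>" if "\<omega> \<in> space A" for \<omega>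
    using that by (intro right_continuous_grid[of "T \<omega>" "\<lambda>u. Z u \<omega>"] nn rc) auto
  show "(\<lambda>\<omega>. Z (grid n (T \<omega>)) \<omega>) \<in> borel_measurable A" for n
    using Z T by (rule measurable_grid_time)
qed

section \<open>Poisson increments and randomly selected sums\<close>

lemma nn_integral_poisson_pmf:
  assumes "0 < rate"
  shows "(\<integral>\<^sup>+k. ennreal (real k) \<partial>poisson_pmf rate) = ennreal rate"
proof -
  have "(\<lambda>k. rate ^ k /\<^sub>R fact k) sums exp rate" by (rule exp_converges)
  then have "(\<lambda>k. (rate * exp (-rate)) * (rate ^ k / fact k)) sums ((rate * exp (-rate)) * exp rate)"
    by (intro sums_mult) (simp add: field_simps)
  also have "(\<lambda>k. (rate * exp (-rate)) * (rate ^ k / fact k)) =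
      (\<lambda>k. real (Suc k) * (rate ^ Suc k / fact (Suc k) * exp (-rate)))"
    by (simp add: fun_eq_iff field_simps del: of_nat_Suc)
  also have "(rate * exp (-rate)) * exp rate = rate" by (simp add: exp_minus field_simps)
  \<comment> \<open>The term with index 0 vanishes, so undoing the shift leaves the sum
    unchanged.\<close>
  finally have "(\<lambda>k. real k * (rate ^ k / fact k * exp (-rate))) sums rate"
    by (subst (asm) sums_Suc_iff) simp
  then have "(\<Sum>k. ennreal (real k * (rate ^ k / fact k * exp (-rate)))) = ennreal rate"
    using assms by (intro suminf_ennreal_eq) auto
  moreover have "(\<integral>\<^sup>+k. ennreal (real k) \<partial>poisson_pmf rate) =
      (\<Sum>k. ennreal (real k * (rate ^ k / fact k * exp (-rate))))"
    using assms
    by (simp add: nn_integral_measure_pmf nn_integral_count_space_nat ennreal_mult'[symmetric] mult.commute)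
  ultimately show ?thesis by simp
qed

lemma poisson_process_measurable:
  assumes "poisson_process M lam N" "0 \<le> t"
  shows "N t \<in> M \<rightarrow>\<^sub>M count_space UNIV"
  using assms by (simp add: poisson_process_def)

lemma poisson_process_mono:
  assumes "poisson_process M lam N" "\<omega> \<in> space M" "0 \<le> s" "s \<le> t"
  shows "N s \<omega> \<le> N t \<omega>"
  using assms by (auto simp: poisson_process_def increasing_cadlag_paths_def mono_on_def)

lemma poisson_process_continuous:
  assumes "poisson_process M lam N" "\<omega> \<in> space M" "0 \<le> t"
  shows "continuous (at_right t) (\<lambda>u. real (N u \<omega>))"
  using assms by (auto simp: poisson_process_def increasing_cadlag_paths_def)

lemma poisson_process_increment:
  assumes pp: "poisson_process M lam N" and "lam > 0" and st: "0 \<le> s" "s < t"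
  shows "integrable M (\<lambda>\<omega>. real (N t \<omega>) - real (N s \<omega>))"
    and "(\<integral>\<omega>. real (N t \<omega>) - real (N s \<omega>) \<partial>M) = lam * (t - s)"
proof -
  have [measurable]: "N s \<in> M \<rightarrow>\<^sub>M count_space UNIV" "N t \<in> M \<rightarrow>\<^sub>M count_space UNIV"
    using st by (auto intro: poisson_process_measurable[OF pp])
  \<comment> \<open>\<open>poisson_process\<close> prescribes the law of a truncated difference of
    naturals; monotone paths make it equal to the real difference.\<close>
  have "(\<integral>\<^sup>+\<omega>. ennreal (real (N t \<omega>) - real (N s \<omega>)) \<partial>M) = (\<integral>\<^sup>+\<omega>. ennreal (real (N t \<omega> - N s \<omega>)) \<partial>M)"
    using poisson_process_mono[OF pp] st by (intro nn_integral_cong) (simp add: of_nat_diff)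
  also have "\<dots> = (\<integral>\<^sup>+k. ennreal (real k) \<partial>distr M (count_space UNIV) (\<lambda>\<omega>. N t \<omega> - N s \<omega>))"
    by (subst nn_integral_distr) auto
  also have "distr M (count_space UNIV) (\<lambda>\<omega>. N t \<omega> - N s \<omega>) = measure_pmf (poisson_pmf (lam * (t - s)))"
    using pp st by (simp add: poisson_process_def)
  also have "(\<integral>\<^sup>+k. ennreal (real k) \<partial>poisson_pmf (lam * (t - s))) = ennreal (lam * (t - s))"
    using assms by (intro nn_integral_poisson_pmf) auto
  finally have "(\<integral>\<^sup>+\<omega>. ennreal (real (N t \<omega>) - real (N s \<omega>)) \<partial>M) = ennreal (lam * (t - s))" .
  then have "integrable M (\<lambda>\<omega>. real (N t \<omega>) - real (N s \<omega>)) \<and>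
      (\<integral>\<omega>. real (N t \<omega>) - real (N s \<omega>) \<partial>M) = lam * (t - s)"
    using assms poisson_process_mono[OF pp]
    by (subst (asm) nn_integral_eq_integrable) auto
  then show "integrable M (\<lambda>\<omega>. real (N t \<omega>) - real (N s \<omega>))"
    and "(\<integral>\<omega>. real (N t \<omega>) - real (N s \<omega>) \<partial>M) = lam * (t - s)" by auto
qed

text \<open>A form of Wald's identity: K counts the selected terms and Z adds them up. The
  probabilities of the selecting events sum to at most the mean of K, and the condition on absolute
  values then makes the means of the absolute terms summable, so sum and integral can be exchanged.
  Only means over the selecting events are assumed, so that Poisson cells and jumps can both be
  inserted.\<close>

lemma (in prob_space) integral_sums_indicator:
  fixes \<xi> :: "nat \<Rightarrow> 'a \<Rightarrow> real" and B :: "nat \<Rightarrow> 'a set" and K :: "'a \<Rightarrow> real"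
  assumes \<xi>: "\<And>i. integrable M (\<xi> i)" and B: "\<And>i. B i \<in> events"
    and mean: "\<And>i. (\<integral>\<omega>. \<xi> i \<omega> * indicator (B i) \<omega> \<partial>M) = m * prob (B i)"
    and mean_abs: "\<And>i. (\<integral>\<omega>. \<bar>\<xi> i \<omega>\<bar> * indicator (B i) \<omega> \<partial>M) = a * prob (B i)"
    and K: "integrable M K" "AE \<omega> in M. (\<lambda>i. indicator (B i) \<omega>) sums K \<omega>"
    and Z: "Z \<in> borel_measurable M" "AE \<omega> in M. (\<lambda>i. \<xi> i \<omega> * indicator (B i) \<omega>) sums Z \<omega>"
  shows "integrable M Z" and "(\<integral>\<omega>. Z \<omega> \<partial>M) = m * (\<integral>\<omega>. K \<omega> \<partial>M)"
proof -
  have intB: "integrable M (\<lambda>\<omega>. indicator (B i) \<omega> :: real)" for i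
    using B by (intro integrable_real_indicator) (simp_all add: less_top[symmetric])
  have bnd: "(\<Sum>i<n. prob (B i)) \<le> (\<integral>\<omega>. K \<omega> \<partial>M)" for n
  proof -
    have "(\<Sum>i<n. prob (B i)) = (\<integral>\<omega>. (\<Sum>i<n. indicator (B i) \<omega>) \<partial>M)"
      using B intB by (subst Bochner_Integration.integral_sum) auto
    also have "\<dots> \<le> (\<integral>\<omega>. K \<omega> \<partial>M)"
    proof (rule integral_mono_AE)
      show "AE \<omega> in M. (\<Sum>i<n. indicator (B i) \<omega>) \<le> K \<omega>"
        using K(2)
      proof eventually_elim
        case (elim \<omega>)
        then show ?case
          using sum_le_suminf[of "\<lambda>i. indicator (B i) \<omega> :: real" "{..<n}"] by (simp add: sums_iff)
      qed
    qed (use intB K(1) in auto)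
    finally show ?thesis .
  qed
  have sum: "summable (\<lambda>i. prob (B i))"
    using bnd by (intro summableI_nonneg_bounded) auto
  \<comment> \<open>A convergent series of indicators has only finitely many nonzero terms, so the
    series of selected terms is a finite sum on almost every path.\<close>
  have AEsum: "AE \<omega> in M. summable (\<lambda>i. norm (\<xi> i \<omega> * indicator (B i) \<omega>))"
    using K(2)
  proof eventually_elim
    case (elim \<omega>)
    then have "(\<lambda>i. indicator (B i) \<omega> :: real) \<longlonglongrightarrow> 0"
      by (intro summable_LIMSEQ_zero) (auto simp: sums_iff)
    then have "\<forall>\<^sub>F i in sequentially. indicator (B i) \<omega> < (1::real)"
      by (rule order_tendstoD) simp
    then obtain n where n: "\<And>i. i \<ge> n \<Longrightarrow> indicator (B i) \<omega> < (1::real)"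
      by (auto simp: eventually_sequentially)
    have "norm (\<xi> i \<omega> * indicator (B i) \<omega>) = 0" if "i \<notin> {..<n}" for i
      using n[of i] that by (cases "\<omega> \<in> B i") auto
    then show ?case by (rule summable_finite[OF finite_lessThan])
  qed
  have int: "integrable M (\<lambda>\<omega>. \<xi> i \<omega> * indicator (B i) \<omega>)" for i
    using integrable_mult_indicator[OF B \<xi>] by (simp add: mult.commute)
  have "summable (\<lambda>i. \<integral>\<omega>. norm (\<xi> i \<omega> * indicator (B i) \<omega>) \<partial>M)"
    using summable_mult[OF sum, of a] by (simp add: abs_mult mean_abs)
  note S = integrable_suminf[OF int AEsum this] sums_integral[OF int AEsum this]
  have Zeq: "AE \<omega> in M. (\<Sum>i. \<xi> i \<omega> * indicator (B i) \<omega>) = Z \<omega>"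
    using Z(2) by eventually_elim (simp add: sums_iff)
  show "integrable M Z"
    by (rule integrable_cong_AE_imp[OF S(1) Z(1)]) (use Zeq in \<open>auto simp: eq_commute\<close>)
  have "(\<integral>\<omega>. (\<Sum>i. \<xi> i \<omega> * indicator (B i) \<omega>) \<partial>M) = (\<integral>\<omega>. Z \<omega> \<partial>M)"
    using Zeq by (intro integral_cong_AE borel_measurable_integrable[OF S(1)] Z(1))
  then have 1: "(\<lambda>i. m * prob (B i)) sums (\<integral>\<omega>. Z \<omega> \<partial>M)" using S(2) by (simp add: mean)
  have AEB: "AE \<omega> in M. summable (\<lambda>i. norm (indicator (B i) \<omega> :: real))"
    using K(2) by eventually_elim (auto simp: sums_iff)
  have "(\<lambda>i. \<integral>\<omega>. indicator (B i) \<omega> \<partial>M) sums (\<integral>\<omega>. (\<Sum>i. indicator (B i) \<omega> :: real) \<partial>M)"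
    by (rule sums_integral[OF intB AEB]) (use B sum in simp)
  also have "(\<integral>\<omega>. (\<Sum>i. indicator (B i) \<omega>) \<partial>M) = (\<integral>\<omega>. K \<omega> \<partial>M)"
  proof (rule integral_cong_AE)
    show "(\<lambda>\<omega>. \<Sum>i. indicator (B i) \<omega> :: real) \<in> borel_measurable M" using B by measurable
    show "AE \<omega> in M. (\<Sum>i. indicator (B i) \<omega>) = K \<omega>"
      using K(2) by eventually_elim (simp add: sums_iff)
  qed (use K in auto)
  finally have "(\<lambda>i. m * prob (B i)) sums (m * (\<integral>\<omega>. K \<omega> \<partial>M))"
    using B by (intro sums_mult) simp
  with 1 show "(\<integral>\<omega>. Z \<omega> \<partial>M) = m * (\<integral>\<omega>. K \<omega> \<partial>M)" by (rule sums_unique2)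
qed

section \<open>Poisson processes at independent random times\<close>

text \<open>The value at time \<open>0\<close> is subtracted because \<open>N 0 = 0\<close> holds only almost surely, while the
  hypotheses on \<open>N\<close> describe its increments.\<close>

definition past_increments :: "'a measure \<Rightarrow> (real \<Rightarrow> 'a \<Rightarrow> nat) \<Rightarrow> real \<Rightarrow> 'a measure" where
  "past_increments M N r = generated_sigma M {0..r} borel (\<lambda>u \<omega>. real (N u \<omega>) - real (N 0 \<omega>))"

lemma space_past_increments [simp]: "space (past_increments M N r) = space M"
  by (simp add: past_increments_def)

lemma (in prob_space) indep_past_increments:
  assumes pp: "poisson_process M lam N" and st: "0 \<le> s" "s \<le> t"
    and ind: "indep_set (sets (generated_sigma M {0..} (count_space UNIV) N)) (sets H)"
    and spH: "space H = space M"
  shows "indep_set (sets (generated_sigma M {()} borel (\<lambda>_ \<omega>. real (N t \<omega>) - real (N s \<omega>))))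
                   (sets (join_sigma M (past_increments M N s) H))"
proof (rule indep_set_join_sigma[OF _ ind])
  have N: "N u \<in> generated_sigma M {0..} (count_space UNIV) N \<rightarrow>\<^sub>M count_space UNIV" if "0 \<le> u" for u
    using that by (intro measurable_generated_sigma) auto
  have N': "(\<lambda>\<omega>. real (N u \<omega>)) \<in> borel_measurable (generated_sigma M {0..} (count_space UNIV) N)" if "0 \<le> u" for u
    using N[OF that] by measurable
  show "indep_set (sets (generated_sigma M {()} borel (\<lambda>_ \<omega>. real (N t \<omega>) - real (N s \<omega>))))
                   (sets (past_increments M N s))"
    unfolding past_increments_def
    using pp st indep_increments_past[of "\<lambda>u \<omega>. real (N u \<omega>)" s t]
    by (simp add: poisson_process_def)
  show "sets (generated_sigma M {()} borel (\<lambda>_ \<omega>. real (N t \<omega>) - real (N s \<omega>)))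
      \<subseteq> sets (generated_sigma M {0..} (count_space UNIV) N)"
    using st by (intro sets_generated_sigma_subset borel_measurable_diff N') auto
  show "sets (past_increments M N s) \<subseteq> sets (generated_sigma M {0..} (count_space UNIV) N)"
    unfolding past_increments_def
    by (intro sets_generated_sigma_subset borel_measurable_diff N') auto
qed (simp_all add: spH)

text \<open>A trace yields an event of the past only up to a null set, so \<open>B\<close> is
  exchanged for \<open>B'\<close> before independence is used and back again afterwards.\<close>

lemma (in prob_space) integral_poisson_increment_indicator:
  assumes pp: "poisson_process M lam N" and lam: "lam > 0" and st: "0 \<le> s" "s < t"
    and ind: "indep_set (sets (generated_sigma M {0..} (count_space UNIV) N)) (sets H)"
    and spH: "space H = space M"
    and B: "B \<in> events" and B': "B' \<in> sets (join_sigma M (past_increments M N s) H)"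
    and eq: "AE \<omega> in M. \<omega> \<in> B \<longleftrightarrow> \<omega> \<in> B'"
  shows "(\<integral>\<omega>. (real (N t \<omega>) - real (N s \<omega>)) * indicator B \<omega> \<partial>M) = lam * (t - s) * prob B"
proof -
  let ?\<xi> = "\<lambda>\<omega>. real (N t \<omega>) - real (N s \<omega>)"
  let ?A = "generated_sigma M {()} borel (\<lambda>_. ?\<xi>)"
  let ?J = "join_sigma M (past_increments M N s) H"
  have I: "indep_set (sets ?A) (sets ?J)"
    using indep_past_increments[OF pp _ _ ind spH] st by simp
  then have B'M: "B' \<in> events" using B' by (auto simp: indep_sets2_eq)
  note \<xi> = poisson_process_increment[OF pp lam st]
  have intB': "integrable M (\<lambda>\<omega>. indicator B' \<omega> :: real)"
    using B'M by (intro integrable_real_indicator) (simp_all add: less_top[symmetric])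
  have "(\<integral>\<omega>. ?\<xi> \<omega> * indicator B \<omega> \<partial>M) = (\<integral>\<omega>. ?\<xi> \<omega> * indicator B' \<omega> \<partial>M)"
  proof (rule integral_cong_AE)
    show "AE \<omega> in M. ?\<xi> \<omega> * indicator B \<omega> = ?\<xi> \<omega> * indicator B' \<omega>"
      using eq by eventually_elim (simp add: indicator_def)
  qed (use B B'M borel_measurable_integrable[OF \<xi>(1)] in auto)
  also have "\<dots> = (\<integral>\<omega>. ?\<xi> \<omega> \<partial>M) * (\<integral>\<omega>. indicator B' \<omega> \<partial>M)"
  proof (rule indep_set_integral_mult(2)[OF I])
    show "?\<xi> \<in> borel_measurable ?A"
      by (rule measurable_generated_sigma[of "()" "{()}" "\<lambda>_. ?\<xi>"]) auto
    show "indicator B' \<in> borel_measurable ?J" using B' by simp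
  qed (use \<xi>(1) intB' in auto)
  also have "(\<integral>\<omega>. indicator B' \<omega> \<partial>M) = prob B'" using B'M by simp
  also have "prob B' = prob B" using eq B B'M by (intro finite_measure_eq_AE) auto
  finally show ?thesis using \<xi>(2) by simp
qed

text \<open>The hypothesis on \<open>C\<close> says that \<open>C\<close> belongs to the past of the stopping time \<open>\<sigma>\<close>; the whole
  \<open>\<sigma>\<close>-algebra \<open>H\<close> of the clock counts as known at time \<open>0\<close>.\<close>

lemma (in prob_space) poisson_grid_time_integral:
  assumes pp: "poisson_process M lam N" and lam: "lam > 0"
    and ind: "indep_set (sets (generated_sigma M {0..} (count_space UNIV) N)) (sets H)"
    and spH: "space H = space M"
    and \<sigma>: "\<sigma> \<in> borel_measurable H" and \<tau>: "\<tau> \<in> borel_measurable H"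
    and nn: "\<And>\<omega>. \<omega> \<in> space M \<Longrightarrow> 0 \<le> \<sigma> \<omega>" "\<And>\<omega>. \<omega> \<in> space M \<Longrightarrow> 0 \<le> \<tau> \<omega>"
    and le: "AE \<omega> in M. \<sigma> \<omega> \<le> \<tau> \<omega>" and int: "integrable M \<tau>"
    and C: "\<And>r. 0 \<le> r \<Longrightarrow>
      C \<in> sets (trace_sigma M (join_sigma M (past_increments M N r) H) {\<omega> \<in> space M. \<sigma> \<omega> < r})"
  shows "integrable M (\<lambda>\<omega>. (real (N (grid n (\<tau> \<omega>)) \<omega>) - real (N (grid n (\<sigma> \<omega>)) \<omega>)) * indicator C \<omega>)"
      (is "integrable M ?Z")
    and "(\<integral>\<omega>. (real (N (grid n (\<tau> \<omega>)) \<omega>) - real (N (grid n (\<sigma> \<omega>)) \<omega>)) * indicator C \<omega> \<partial>M) =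
      lam * (\<integral>\<omega>. (grid n (\<tau> \<omega>) - grid n (\<sigma> \<omega>)) * indicator C \<omega> \<partial>M)"
proof -
  let ?J = "\<lambda>r. join_sigma M (past_increments M N r) H"
  have HM: "sets H \<subseteq> events" using ind by (simp add: indep_sets2_eq)
  have [measurable]: "\<sigma> \<in> borel_measurable M" "\<tau> \<in> borel_measurable M"
    using \<sigma> \<tau> HM spH by (auto intro: measurable_mono_sets)
  have HJ: "sets H \<subseteq> sets (?J r)" for r by (rule sets_join_sigma2) (simp_all add: spH)
  have less_in: "{\<omega> \<in> space M. \<sigma> \<omega> < r} \<in> sets (?J r)" for r
    using measurable_sets[OF \<sigma>, of "{..<r}"] HJ[of r] by (auto simp: spH vimage_def Int_def conj_commute)
  have ge_in: "{\<omega> \<in> space M. r \<le> \<tau> \<omega>} \<in> sets (?J r)" for r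
    using measurable_sets[OF \<tau>, of "{r..}"] HJ[of r] by (auto simp: spH vimage_def Int_def conj_commute)
  note C' = C[unfolded sets_trace_sigma[OF less_in space_join_sigma]]
  have [measurable]: "C \<in> events" using C'[of 0] by auto
  define t where "t j = real j / real (Suc n)" for j
  have t: "0 \<le> t j" "t j < t (Suc j)" "t (Suc j) - t j = 1 / real (Suc n)" for j
    by (auto simp: t_def field_simps)
  define \<xi> where "\<xi> j \<omega> = real (N (t (Suc j)) \<omega>) - real (N (t j) \<omega>)" for j \<omega>
  \<comment> \<open>The cell from \<open>t j\<close> to \<open>t (Suc j)\<close> counts exactly when
    it lies between the grid points of \<sigma> and \<tau>. On C this is known at time
    \<open>t j\<close>: the trace hypothesis covers C with \<sigma> < \<open>t j\<close>, and \<tau>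
    is measurable for the clock.\<close>
  define B where "B j = {\<omega> \<in> space M. \<omega> \<in> C \<and> \<sigma> \<omega> < t j \<and> t j \<le> \<tau> \<omega>}" for j
  have B: "B j \<in> events" for j unfolding B_def by measurable
  define K where "K \<omega> = (real (grid_index n (\<tau> \<omega>)) - real (grid_index n (\<sigma> \<omega>))) * indicator C \<omega>" for \<omega>
  have indB: "indicator (B j) \<omega> =
      (if j \<in> {grid_index n (\<sigma> \<omega>)..<grid_index n (\<tau> \<omega>)} then indicator C \<omega> else 0 :: real)"
    if "\<omega> \<in> space M" for j \<omega>
    using that grid_index_le_iff[OF nn(1)[OF that], of n j] grid_index_le_iff[OF nn(2)[OF that], of n j]
    by (auto simp: B_def indicator_def t_def not_less not_le)
  have gi_le: "grid_index n (\<sigma> \<omega>) \<le> grid_index n (\<tau> \<omega>)" if "\<omega> \<in> space M" "\<sigma> \<omega> \<le> \<tau> \<omega>" for \<omega>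
    unfolding grid_index_le_iff[OF nn(1)[OF that(1)]]
    using grid_greater[OF nn(2)[OF that(1)], of n] that(2) by (simp add: grid_def)
  have mean: "(\<integral>\<omega>. \<xi> j \<omega> * indicator (B j) \<omega> \<partial>M) = lam * (1 / real (Suc n)) * prob (B j)" for j
  proof -
    obtain C'' where C'': "C'' \<in> sets (?J (t j))"
      and eq: "AE \<omega> in M. (\<omega> \<in> C \<and> \<omega> \<in> {\<omega> \<in> space M. \<sigma> \<omega> < t j}) = (\<omega> \<in> C'')"
      using C'[OF t(1)[of j]] by auto
    have "AE \<omega> in M. \<omega> \<in> B j \<longleftrightarrow> \<omega> \<in> C'' \<inter> {\<omega> \<in> space M. t j \<le> \<tau> \<omega>}"
      using eq by eventually_elim (auto simp: B_def)
    then have "(\<integral>\<omega>. \<xi> j \<omega> * indicator (B j) \<omega> \<partial>M) = lam * (t (Suc j) - t j) * prob (B j)"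
      unfolding \<xi>_def
      by (rule integral_poisson_increment_indicator[OF pp lam t(1,2) ind spH B sets.Int[OF C'' ge_in]])
    then show ?thesis by (simp only: t(3))
  qed
  have \<xi>_nn: "0 \<le> \<xi> j \<omega>" if "\<omega> \<in> space M" for j \<omega>
    using poisson_process_mono[OF pp that t(1)[of j] less_imp_le[OF t(2)[of j]]] by (simp add: \<xi>_def)
  have \<xi>_int: "integrable M (\<xi> j)" for j
    unfolding \<xi>_def using t by (intro poisson_process_increment(1)[OF pp lam]) auto
  have mean_abs: "(\<integral>\<omega>. \<bar>\<xi> j \<omega>\<bar> * indicator (B j) \<omega> \<partial>M) = lam * (1 / real (Suc n)) * prob (B j)" for j
    unfolding mean[symmetric] by (intro Bochner_Integration.integral_cong) (auto simp: \<xi>_nn)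
  have K: "integrable M K"
  proof (rule Bochner_Integration.integrable_bound)
    show "integrable M (\<lambda>\<omega>. \<tau> \<omega> * real (Suc n) + 1)" using int by auto
    show "AE \<omega> in M. norm (K \<omega>) \<le> norm (\<tau> \<omega> * real (Suc n) + 1)"
      using le AE_space
    proof eventually_elim
      case (elim \<omega>)
      have "real (grid_index n (\<tau> \<omega>)) \<le> \<tau> \<omega> * real (Suc n) + 1"
        using nn(2)[OF elim(2)] of_int_floor_le[of "\<tau> \<omega> * real (Suc n)"] by (simp add: grid_index_def)
      then show ?case
        using gi_le[OF elim(2,1)] nn(2)[OF elim(2)] by (auto simp: K_def indicator_def)
    qed
  qed (unfold K_def, measurable)
  have Ksums: "AE \<omega> in M. (\<lambda>j. indicator (B j) \<omega>) sums K \<omega>"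
    using le AE_space
  proof eventually_elim
    case (elim \<omega>)
    have "(\<Sum>j\<in>{grid_index n (\<sigma> \<omega>)..<grid_index n (\<tau> \<omega>)}. indicator C \<omega>) = K \<omega>"
      using gi_le[OF elim(2,1)] by (simp add: K_def of_nat_diff)
    then show ?case
      using sums_If_finite_set[of "{grid_index n (\<sigma> \<omega>)..<grid_index n (\<tau> \<omega>)}" "\<lambda>_. indicator C \<omega> :: real"]
      by (simp only: indB[OF elim(2)] finite_atLeastLessThan simp_thms)
  qed
  have Zsums: "AE \<omega> in M. (\<lambda>j. \<xi> j \<omega> * indicator (B j) \<omega>) sums ?Z \<omega>"
    using le AE_space
  proof eventually_elim
    case (elim \<omega>)
    let ?I = "{grid_index n (\<sigma> \<omega>)..<grid_index n (\<tau> \<omega>)}"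
    have "(\<Sum>j\<in>?I. \<xi> j \<omega>) = real (N (grid n (\<tau> \<omega>)) \<omega>) - real (N (grid n (\<sigma> \<omega>)) \<omega>)"
      unfolding \<xi>_def grid_def t_def[symmetric]
      by (rule sum_Suc_diff'[of _ _ "\<lambda>j. real (N (t j) \<omega>)"]) (rule gi_le[OF elim(2,1)])
    then have "(\<Sum>j\<in>?I. \<xi> j \<omega> * indicator C \<omega>) = ?Z \<omega>" by (simp add: sum_distrib_right[symmetric])
    moreover have "(\<lambda>j. \<xi> j \<omega> * indicator (B j) \<omega>) = (\<lambda>j. if j \<in> ?I then \<xi> j \<omega> * indicator C \<omega> else 0)"
      by (simp add: indB[OF elim(2)] fun_eq_iff)
    ultimately show ?case
      using sums_If_finite_set[of ?I "\<lambda>j. \<xi> j \<omega> * indicator C \<omega>"]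
      by (simp only: finite_atLeastLessThan simp_thms)
  qed
  have NM: "(\<lambda>\<omega>. real (N u \<omega>)) \<in> borel_measurable M" if "0 \<le> u" for u
    using poisson_process_measurable[OF pp that] by measurable
  have [measurable]: "(\<lambda>\<omega>. real (N (grid n (\<tau> \<omega>)) \<omega>)) \<in> borel_measurable M"
     "(\<lambda>\<omega>. real (N (grid n (\<sigma> \<omega>)) \<omega>)) \<in> borel_measurable M"
    using NM by (auto intro!: measurable_grid_time[where Z="\<lambda>u \<omega>. real (N u \<omega>)"])
  have "?Z \<in> borel_measurable M" by measurable
  note S = integral_sums_indicator[OF \<xi>_int B mean mean_abs K Ksums this Zsums]
  show "integrable M ?Z" by (rule S(1))
  \<comment> \<open>K counts cells of length 1/(n+1), hence is n+1 times the distance of the two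
    grid points on C.\<close>
  have "(\<lambda>\<omega>. (grid n (\<tau> \<omega>) - grid n (\<sigma> \<omega>)) * indicator C \<omega>) = (\<lambda>\<omega>. (1 / real (Suc n)) * K \<omega>)"
    by (simp add: fun_eq_iff grid_def K_def diff_divide_distrib left_diff_distrib)
  then show "(\<integral>\<omega>. ?Z \<omega> \<partial>M) = lam * (\<integral>\<omega>. (grid n (\<tau> \<omega>) - grid n (\<sigma> \<omega>)) * indicator C \<omega> \<partial>M)"
    using S(2) by simp
qed

text \<open>Both sides of the grid identity converge by dominated convergence: N at
  \<open>grid 0 (\<tau> \<omega>)\<close> dominates the counts for every n, and \<tau> + 1 dominates
  the time differences.\<close>

lemma (in prob_space) poisson_random_time_integral:
  assumes pp: "poisson_process M lam N" and lam: "lam > 0"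
    and ind: "indep_set (sets (generated_sigma M {0..} (count_space UNIV) N)) (sets H)"
    and spH: "space H = space M"
    and \<sigma>: "\<sigma> \<in> borel_measurable H" and \<tau>: "\<tau> \<in> borel_measurable H"
    and nn: "\<And>\<omega>. \<omega> \<in> space M \<Longrightarrow> 0 \<le> \<sigma> \<omega>" "\<And>\<omega>. \<omega> \<in> space M \<Longrightarrow> 0 \<le> \<tau> \<omega>"
    and le: "AE \<omega> in M. \<sigma> \<omega> \<le> \<tau> \<omega>" and int: "integrable M \<tau>"
    and C: "\<And>r. 0 \<le> r \<Longrightarrow>
      C \<in> sets (trace_sigma M (join_sigma M (past_increments M N r) H) {\<omega> \<in> space M. \<sigma> \<omega> < r})"
  shows "integrable M (\<lambda>\<omega>. real (N (\<tau> \<omega>) \<omega>))"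
    and "(\<integral>\<omega>. (real (N (\<tau> \<omega>) \<omega>) - real (N (\<sigma> \<omega>) \<omega>)) * indicator C \<omega> \<partial>M) =
      lam * (\<integral>\<omega>. (\<tau> \<omega> - \<sigma> \<omega>) * indicator C \<omega> \<partial>M)"
proof -
  have HM: "sets H \<subseteq> events" using ind by (simp add: indep_sets2_eq)
  have M[measurable]: "\<sigma> \<in> borel_measurable M" "\<tau> \<in> borel_measurable M"
    using \<sigma> \<tau> HM spH by (auto intro: measurable_mono_sets)
  have NM: "(\<lambda>\<omega>. real (N u \<omega>)) \<in> borel_measurable M" if "0 \<le> u" for u
    using poisson_process_measurable[OF pp that] by measurable
  have [measurable]: "(\<lambda>\<omega>. real (N (grid n (\<tau> \<omega>)) \<omega>)) \<in> borel_measurable M"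
     "(\<lambda>\<omega>. real (N (grid n (\<sigma> \<omega>)) \<omega>)) \<in> borel_measurable M" for n
    using NM by (auto intro!: measurable_grid_time[where Z="\<lambda>u \<omega>. real (N u \<omega>)"])
  have [measurable]: "(\<lambda>\<omega>. real (N (\<tau> \<omega>) \<omega>)) \<in> borel_measurable M"
     "(\<lambda>\<omega>. real (N (\<sigma> \<omega>) \<omega>)) \<in> borel_measurable M"
    using measurable_random_time[of "\<lambda>u \<omega>. real (N u \<omega>)" M, OF NM M(2) nn(2) poisson_process_continuous[OF pp]]
      measurable_random_time[of "\<lambda>u \<omega>. real (N u \<omega>)" M, OF NM M(1) nn(1) poisson_process_continuous[OF pp]]
    by simp_all
  have [measurable]: "C \<in> events"
    using C[of 0] sets_trace_sigma_subset by blast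
  have grid_mono: "grid n (\<sigma> \<omega>) \<le> grid n (\<tau> \<omega>)" if "\<omega> \<in> space M" "\<sigma> \<omega> \<le> \<tau> \<omega>" for n \<omega>
    using that nn by (auto simp: grid_def grid_index_def intro!: divide_right_mono nat_mono floor_mono mult_right_mono)
  \<comment> \<open>The grid result is used with \<sigma> = 0 and the whole space as C. As grid
    points lie strictly above their argument, \<open>grid 0 0\<close> is 1 and not 0, so N(1) has to
    be added back; it is integrable because N(0) = 0 almost surely.\<close>
  have int0: "integrable M (\<lambda>\<omega>. real (N (grid 0 (\<tau> \<omega>)) \<omega>))"
  proof -
    have "integrable M (\<lambda>\<omega>. (real (N (grid 0 (\<tau> \<omega>)) \<omega>) - real (N (grid 0 0) \<omega>)) * indicator (space M) \<omega>)"
      using \<tau> nn int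
      by (intro poisson_grid_time_integral(1)[OF pp lam ind spH])
         (auto intro!: sets.top[of "trace_sigma _ _ _", simplified])
    then have "integrable M (\<lambda>\<omega>. real (N (grid 0 (\<tau> \<omega>)) \<omega>) - real (N (grid 0 0) \<omega>))"
      by (subst (asm) Bochner_Integration.integrable_cong[OF refl]) (auto simp: indicator_def)
    moreover have "integrable M (\<lambda>\<omega>. real (N (grid 0 0) \<omega>))"
    proof (rule integrable_cong_AE_imp)
      show "integrable M (\<lambda>\<omega>. real (N (grid 0 0) \<omega>) - real (N 0 \<omega>))"
        using grid_greater[of 0 0] by (intro poisson_process_increment(1)[OF pp lam]) auto
      have "AE \<omega> in M. N 0 \<omega> = 0" using pp by (simp add: poisson_process_def)
      then show "AE \<omega> in M. real (N (grid 0 0) \<omega>) - real (N 0 \<omega>) = real (N (grid 0 0) \<omega>)"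
        by eventually_elim simp
    qed (rule NM, simp)
    ultimately have "integrable M (\<lambda>\<omega>. (real (N (grid 0 (\<tau> \<omega>)) \<omega>) - real (N (grid 0 0) \<omega>)) + real (N (grid 0 0) \<omega>))"
      by (rule Bochner_Integration.integrable_add)
    then show ?thesis by simp
  qed
  show "integrable M (\<lambda>\<omega>. real (N (\<tau> \<omega>) \<omega>))"
  proof (rule Bochner_Integration.integrable_bound[OF int0])
    show "AE \<omega> in M. norm (real (N (\<tau> \<omega>) \<omega>)) \<le> norm (real (N (grid 0 (\<tau> \<omega>)) \<omega>))"
      using nn grid_greater by (intro AE_I2) (simp add: poisson_process_mono[OF pp] less_imp_le)
  qed measurable
  have lim1: "(\<lambda>n. \<integral>\<omega>. (real (N (grid n (\<tau> \<omega>)) \<omega>) - real (N (grid n (\<sigma> \<omega>)) \<omega>)) * indicator C \<omega> \<partial>M)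
    \<longlonglongrightarrow> (\<integral>\<omega>. (real (N (\<tau> \<omega>) \<omega>) - real (N (\<sigma> \<omega>) \<omega>)) * indicator C \<omega> \<partial>M)"
  proof (rule integral_dominated_convergence[OF _ _ int0])
    show "AE \<omega> in M. (\<lambda>n. (real (N (grid n (\<tau> \<omega>)) \<omega>) - real (N (grid n (\<sigma> \<omega>)) \<omega>)) * indicator C \<omega>)
      \<longlonglongrightarrow> (real (N (\<tau> \<omega>) \<omega>) - real (N (\<sigma> \<omega>) \<omega>)) * indicator C \<omega>"
    proof (rule AE_I2)
      fix \<omega> assume \<omega>: "\<omega> \<in> space M"
      show "(\<lambda>n. (real (N (grid n (\<tau> \<omega>)) \<omega>) - real (N (grid n (\<sigma> \<omega>)) \<omega>)) * indicator C \<omega>)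
        \<longlonglongrightarrow> (real (N (\<tau> \<omega>) \<omega>) - real (N (\<sigma> \<omega>) \<omega>)) * indicator C \<omega>"
        using nn[OF \<omega>] poisson_process_continuous[OF pp \<omega>]
        by (intro tendsto_mult_right tendsto_diff right_continuous_grid[where f="\<lambda>u. real (N u \<omega>)"]) auto
    qed
    show "AE \<omega> in M. norm ((real (N (grid n (\<tau> \<omega>)) \<omega>) - real (N (grid n (\<sigma> \<omega>)) \<omega>)) * indicator C \<omega>)
        \<le> real (N (grid 0 (\<tau> \<omega>)) \<omega>)" for n
      using le AE_space
    proof eventually_elim
      case (elim \<omega>)
      have "N (grid n (\<sigma> \<omega>)) \<omega> \<le> N (grid n (\<tau> \<omega>)) \<omega>"
        using grid_mono[OF elim(2,1)] by (intro poisson_process_mono[OF pp elim(2)]) auto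
      moreover have "N (grid n (\<tau> \<omega>)) \<omega> \<le> N (grid 0 (\<tau> \<omega>)) \<omega>"
        using grid_le_grid_0 nn(2)[OF elim(2)] by (intro poisson_process_mono[OF pp elim(2)]) auto
      ultimately show ?case by (auto simp: indicator_def)
    qed
  qed measurable
  have "(\<lambda>n. \<integral>\<omega>. (grid n (\<tau> \<omega>) - grid n (\<sigma> \<omega>)) * indicator C \<omega> \<partial>M)
    \<longlonglongrightarrow> (\<integral>\<omega>. (\<tau> \<omega> - \<sigma> \<omega>) * indicator C \<omega> \<partial>M)"
  proof (rule integral_dominated_convergence)
    show "integrable M (\<lambda>\<omega>. \<tau> \<omega> + 1)" using int by auto
    show "AE \<omega> in M. (\<lambda>n. (grid n (\<tau> \<omega>) - grid n (\<sigma> \<omega>)) * indicator C \<omega>)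
      \<longlonglongrightarrow> (\<tau> \<omega> - \<sigma> \<omega>) * indicator C \<omega>"
      using nn by (intro AE_I2 tendsto_mult_right tendsto_diff right_continuous_grid[where f="\<lambda>x. x"])
         (auto intro: continuous_intros)
    show "AE \<omega> in M. norm ((grid n (\<tau> \<omega>) - grid n (\<sigma> \<omega>)) * indicator C \<omega>) \<le> \<tau> \<omega> + 1" for n
      using le AE_space
    proof eventually_elim
      case (elim \<omega>)
      have "1 / real (Suc n) \<le> 1" by simp
      then have "grid n (\<tau> \<omega>) \<le> \<tau> \<omega> + 1"
        using grid_le[OF nn(2)[OF elim(2)], of n] by linarith
      then have "grid n (\<tau> \<omega>) - grid n (\<sigma> \<omega>) \<le> \<tau> \<omega> + 1"
        using grid_nonneg[of n "\<sigma> \<omega>"] by linarith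
      then show ?case
        using grid_mono[OF elim(2,1), of n] nn(2)[OF elim(2)] by (auto simp: indicator_def)
    qed
  qed (unfold grid_def, measurable)
  then have lim2: "(\<lambda>n. lam * (\<integral>\<omega>. (grid n (\<tau> \<omega>) - grid n (\<sigma> \<omega>)) * indicator C \<omega> \<partial>M))
    \<longlonglongrightarrow> lam * (\<integral>\<omega>. (\<tau> \<omega> - \<sigma> \<omega>) * indicator C \<omega> \<partial>M)"
    by (rule tendsto_mult_left)
  have "(\<integral>\<omega>. (real (N (grid n (\<tau> \<omega>)) \<omega>) - real (N (grid n (\<sigma> \<omega>)) \<omega>)) * indicator C \<omega> \<partial>M) =
      lam * (\<integral>\<omega>. (grid n (\<tau> \<omega>) - grid n (\<sigma> \<omega>)) * indicator C \<omega> \<partial>M)" for n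
    using nn le int C by (intro poisson_grid_time_integral(2)[OF pp lam ind spH \<sigma> \<tau>]) auto
  then show "(\<integral>\<omega>. (real (N (\<tau> \<omega>) \<omega>) - real (N (\<sigma> \<omega>) \<omega>)) * indicator C \<omega> \<partial>M) =
      lam * (\<integral>\<omega>. (\<tau> \<omega> - \<sigma> \<omega>) * indicator C \<omega> \<partial>M)"
    using lim1 lim2 by (simp add: LIMSEQ_unique)
qed

section \<open>Inverse subordinators\<close>

lemma inverse_process_nonneg: "0 \<le> inverse_process D t \<omega>"
  by (auto simp: inverse_process_def Let_def intro!: cInf_greatest)

text \<open>If the level t were never exceeded, the default value 0 at t could fall below the value
  at s. Hence the clock is monotone only where the larger level is exceeded, which is an almost sure
  statement.\<close>

lemma inverse_process_mono:
  assumes "s \<le> t" "\<exists>r\<ge>0. t < D r \<omega>"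
  shows "inverse_process D s \<omega> \<le> inverse_process D t \<omega>"
proof -
  have "{r. 0 \<le> r \<and> t < D r \<omega>} \<noteq> {}" using assms(2) by auto
  moreover have "{r. 0 \<le> r \<and> t < D r \<omega>} \<subseteq> {r. 0 \<le> r \<and> s < D r \<omega>}" using assms(1) by auto
  moreover have "bdd_below {r. 0 \<le> r \<and> s < D r \<omega>}" by (rule bdd_belowI[of _ 0]) auto
  ultimately show ?thesis
    unfolding inverse_process_def Let_def by (auto intro!: cInf_superset_mono)
qed

text \<open>The default value 0 is harmless here: it leaves no r with 0 \<le> r below it. Otherwise
  r lies below an infimum and so outside the set.\<close>

lemma below_inverse_process:
  assumes "0 \<le> r" "r < inverse_process D t \<omega>"
  shows "D r \<omega> \<le> t"
proof (rule ccontr)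
  assume "\<not> D r \<omega> \<le> t"
  then have r: "r \<in> {r. 0 \<le> r \<and> t < D r \<omega>}" using assms by auto
  moreover have "bdd_below {r. 0 \<le> r \<and> t < D r \<omega>}" by (rule bdd_belowI[of _ 0]) auto
  ultimately have "Inf {r. 0 \<le> r \<and> t < D r \<omega>} \<le> r" by (rule cInf_lower)
  then show False using assms(2) r by (auto simp: inverse_process_def Let_def split: if_splits)
qed

text \<open>The integrand 1 - exp(-x) is positive on the open half-line, so a zero integral would
  leave that half-line without mass, against the infinite total mass.\<close>

lemma bernstein_fun_pos:
  assumes b: "b \<ge> 0" and \<nu>: "levy_measure_pos \<nu>" and inf: "emeasure \<nu> {0..} = \<infinity>"
  shows "0 < bernstein_fun b \<nu> 1"
proof -
  have [measurable_cong]: "sets \<nu> = sets borel" and z: "emeasure \<nu> {..0} = 0"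
    and fin: "(\<integral>\<^sup>+x. ennreal (min x 1) * indicator {0<..} x \<partial>\<nu>) < \<infinity>"
    using \<nu> by (auto simp: levy_measure_pos_def)
  let ?f = "\<lambda>x::real. indicator {0<..} x *\<^sub>R (1 - exp (- 1 * x))"
  have nn: "0 \<le> ?f x" for x by (simp add: indicator_def)
  \<comment> \<open>Integrability has to come first, since the Bochner integral of a non-integrable
    function is 0 by convention. The bound is 1 - exp(-x) \<le> min(x, 1).\<close>
  have int: "integrable \<nu> ?f"
  proof (rule integrableI_bounded)
    have "(\<integral>\<^sup>+x. ennreal (norm (?f x)) \<partial>\<nu>) \<le> (\<integral>\<^sup>+x. ennreal (min x 1) * indicator {0<..} x \<partial>\<nu>)"
    proof (rule nn_integral_mono)
      fix x :: real
      have "1 - exp (- x) \<le> min x 1" using exp_ge_add_one_self[of "-x"] by auto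
      then show "ennreal (norm (?f x)) \<le> ennreal (min x 1) * indicator {0<..} x"
        by (auto simp: indicator_def intro!: ennreal_leI)
    qed
    then show "(\<integral>\<^sup>+x. ennreal (norm (?f x)) \<partial>\<nu>) < \<infinity>" using fin by (rule le_less_trans)
  qed measurable
  have "(\<integral>x. ?f x \<partial>\<nu>) \<noteq> 0"
  proof
    assume "(\<integral>x. ?f x \<partial>\<nu>) = 0"
    then have "AE x in \<nu>. ?f x = 0" using integral_nonneg_eq_0_iff_AE[OF int] nn by simp
    then have "AE x in \<nu>. x \<notin> {0<..}" by eventually_elim (auto simp: indicator_def)
    then have "emeasure \<nu> {0<..} = 0" by (subst (asm) AE_iff_measurable[OF _ refl]) (auto simp: greaterThan_def sets_eq_imp_space_eq[OF \<open>sets \<nu> = sets borel\<close>])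
    moreover have "emeasure \<nu> {0..} \<le> emeasure \<nu> ({..0} \<union> {0<..})" by (rule emeasure_mono) auto
    moreover have "emeasure \<nu> ({..0} \<union> {0<..}) \<le> emeasure \<nu> {..0} + emeasure \<nu> {0<..}"
      by (rule emeasure_subadditive) auto
    ultimately show False using inf z by (simp add: top_unique)
  qed
  moreover have "0 \<le> (\<integral>x. ?f x \<partial>\<nu>)" using nn by (intro integral_nonneg_AE) auto
  ultimately show ?thesis
    using b by (simp add: bernstein_fun_def set_lebesgue_integral_def)
qed

text \<open>exp(t - D(n)) dominates the indicator of D(n) \<le> t and has mean exp(t) exp(-f(1))^n,
  a geometric sequence. Keeping the series inside the integral gives one random variable that both
  dominates E(t) and forces D to exceed t almost surely.\<close>

lemma nn_integral_sum_exp_subordinator: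
  assumes D: "subordinator_with_exponent M f D" and f: "0 < f 1"
  shows "(\<integral>\<^sup>+\<omega>. (\<Sum>n. ennreal (exp (t - D (real n) \<omega>))) \<partial>M) < \<infinity>"
proof -
  have [measurable]: "D (real n) \<in> borel_measurable M" for n
    using D by (auto simp: subordinator_with_exponent_def subordinator_def)
  have *: "(\<integral>\<^sup>+\<omega>. ennreal (exp (t - D (real n) \<omega>)) \<partial>M) = ennreal (exp t * exp (- f 1) ^ n)" for n
  proof -
    have L: "(\<integral>\<omega>. exp (- 1 * D (real n) \<omega>) \<partial>M) = exp (- real n * f 1)"
      using D[unfolded subordinator_with_exponent_def, THEN conjunct2, rule_format, of "real n" 1] by simp
    \<comment> \<open>The Laplace transform is nonzero, while a non-integrable function would have
      integral 0.\<close>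
    then have "integrable M (\<lambda>\<omega>. exp (- 1 * D (real n) \<omega>))"
      using not_integrable_integral_eq by fastforce
    then have "(\<integral>\<^sup>+\<omega>. ennreal (exp (- 1 * D (real n) \<omega>)) \<partial>M) = ennreal (exp (- real n * f 1))"
      unfolding L[symmetric] by (rule nn_integral_eq_integral) auto
    then have "ennreal (exp t) * (\<integral>\<^sup>+\<omega>. ennreal (exp (- 1 * D (real n) \<omega>)) \<partial>M) =
        ennreal (exp t * exp (- f 1) ^ n)"
      by (simp add: ennreal_mult exp_of_nat_mult[symmetric])
    then show ?thesis
      by (subst (asm) nn_integral_cmult[symmetric])
         (auto simp: ennreal_mult[symmetric] exp_add[symmetric] exp_diff exp_minus divide_inverse)
  qed
  have "(\<integral>\<^sup>+\<omega>. (\<Sum>n. ennreal (exp (t - D (real n) \<omega>))) \<partial>M) = (\<Sum>n. ennreal (exp t * exp (- f 1) ^ n))"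
    by (subst nn_integral_suminf) (auto simp: *)
  also have "summable (\<lambda>n. exp t * exp (- f 1) ^ n)"
    using f by (intro summable_mult summable_geometric) auto
  then have "(\<Sum>n. ennreal (exp t * exp (- f 1) ^ n)) \<noteq> \<infinity>"
    unfolding infinity_ennreal_def by (rule ennreal_suminf_neq_top) simp
  finally show ?thesis by (simp add: less_top)
qed

lemma of_nat_le_suminf_exp:
  assumes "\<And>n. n < k \<Longrightarrow> D (real n) \<omega> \<le> t"
  shows "of_nat k \<le> (\<Sum>n. ennreal (exp (t - D (real n) \<omega>)))"
proof -
  have "of_nat k = (\<Sum>n<k. 1 :: ennreal)" by simp
  also have "\<dots> \<le> (\<Sum>n<k. ennreal (exp (t - D (real n) \<omega>)))"
    using assms by (intro sum_mono) (auto simp: ennreal_leI ennreal_1[symmetric] simp del: ennreal_1)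
  also have "\<dots> \<le> (\<Sum>n. ennreal (exp (t - D (real n) \<omega>)))"
    by (intro sum_le_suminf) auto
  finally show ?thesis .
qed

text \<open>On a path that never exceeds t every term of the exponential series is at least 1, so
  the series diverges; almost surely it is finite.\<close>

lemma subordinator_exceeds:
  assumes D: "subordinator_with_exponent M f D" and f: "0 < f 1"
  shows "AE \<omega> in M. \<exists>r\<ge>0. t < D r \<omega>"
proof -
  have [measurable]: "D (real n) \<in> borel_measurable M" for n
    using D by (auto simp: subordinator_with_exponent_def subordinator_def)
  have "AE \<omega> in M. (\<Sum>n. ennreal (exp (t - D (real n) \<omega>))) \<noteq> \<infinity>"
    using nn_integral_sum_exp_subordinator[OF D f, of t] by (intro nn_integral_PInf_AE) auto
  then show ?thesis
  proof eventually_elim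
    case (elim \<omega>)
    show ?case
    proof (rule ccontr)
      assume "\<not> (\<exists>r\<ge>0. t < D r \<omega>)"
      then have "of_nat k \<le> (\<Sum>n. ennreal (exp (t - D (real n) \<omega>)))" for k
        by (intro of_nat_le_suminf_exp) (auto simp: not_less)
      then show False
        using elim ennreal_Ex_less_of_nat by (metis infinity_ennreal_def leD less_top)
    qed
  qed
qed

lemma integrable_inverse_process:
  assumes D: "subordinator_with_exponent M f D" and f: "0 < f 1"
    and E: "inverse_process D t \<in> borel_measurable M"
  shows "integrable M (inverse_process D t)"
proof (rule integrableI_bounded[OF E])
  have "(\<integral>\<^sup>+\<omega>. ennreal (norm (inverse_process D t \<omega>)) \<partial>M) \<le> (\<integral>\<^sup>+\<omega>. (\<Sum>n. ennreal (exp (t - D (real n) \<omega>))) \<partial>M)"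
  proof (rule nn_integral_mono)
    fix \<omega>
    let ?E = "inverse_process D t \<omega>"
    \<comment> \<open>The ceiling of E(t) counts the naturals n < E(t). Each has D(n) \<le> t and
      contributes a term of at least 1 to the series.\<close>
    have "ennreal (norm ?E) \<le> ennreal (real (nat \<lceil>?E\<rceil>))"
      using inverse_process_nonneg[of D t \<omega>] by (intro ennreal_leI) (simp add: real_nat_ceiling_ge)
    also have "\<dots> = of_nat (nat \<lceil>?E\<rceil>)" by (rule ennreal_of_nat_eq_real_of_nat[symmetric])
    also have "\<dots> \<le> (\<Sum>n. ennreal (exp (t - D (real n) \<omega>)))"
    proof (rule of_nat_le_suminf_exp)
      fix n assume "n < nat \<lceil>?E\<rceil>"
      then have "real n < ?E" by (simp add: zless_nat_eq_int_zless less_ceiling_iff)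
      then show "D (real n) \<omega> \<le> t" by (intro below_inverse_process[of "real n" D t]) auto
    qed
    finally show "ennreal (norm ?E) \<le> (\<Sum>n. ennreal (exp (t - D (real n) \<omega>)))" .
  qed
  then show "(\<integral>\<^sup>+\<omega>. ennreal (norm (inverse_process D t \<omega>)) \<partial>M) < \<infinity>"
    using nn_integral_sum_exp_subordinator[OF D f, of t] by (rule le_less_trans)
qed

section \<open>Compensators\<close>

lemma right_continuous_min:
  fixes f :: "real \<Rightarrow> real"
  assumes "continuous (at_right u) f"
  shows "continuous (at_right u) (\<lambda>v. f (min r v))"
proof (cases "u < r")
  case True
  have "((\<lambda>v. f (min r v)) \<longlongrightarrow> f u) (at_right u)"
  proof (rule Lim_transform_eventually)
    show "(f \<longlongrightarrow> f u) (at_right u)" using assms by (simp add: continuous_within)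
    show "\<forall>\<^sub>F v in at_right u. f v = f (min r v)"
      using eventually_at_right_less[of u] True
      by (auto simp: eventually_at_right_field min_def intro!: exI[of _ r])
  qed
  then show ?thesis using True by (simp add: continuous_within min_def)
next
  case False
  have "((\<lambda>v. f (min r v)) \<longlongrightarrow> f r) (at_right u)"
  proof (rule Lim_transform_eventually[OF tendsto_const])
    show "\<forall>\<^sub>F v in at_right u. f r = f (min r v)"
      using False by (auto simp: eventually_at_right_field min_def intro!: exI[of _ "u + 1"])
  qed
  then show ?thesis using False by (simp add: continuous_within min_def)
qed

text \<open>The random times are \<sigma> = E(s) and \<tau> = E(t), both measurable for the clock.
  What has to be shown is that C belongs to the past of E(s); this is checked on the generators
  N_f(u) and E(u) with u \<le> s.\<close>

lemma (in prob_space) time_changed_poisson_compensator: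
  assumes pp: "poisson_process M lam N" and lam: "lam > 0"
    and ind: "indep_families M {0..} (count_space UNIV) N {0..} borel E"
    and nn: "\<And>t \<omega>. 0 \<le> E t \<omega>"
    and mono: "\<And>u v. 0 \<le> u \<Longrightarrow> u \<le> v \<Longrightarrow> AE \<omega> in M. E u \<omega> \<le> E v \<omega>"
    and int: "\<And>t. 0 \<le> t \<Longrightarrow> integrable M (E t)"
    and st: "0 \<le> s" "s \<le> t"
    and C: "C \<in> sets (join_sigma M (natural_filtration M (count_space UNIV) (time_change N E) s)
                                     (natural_filtration M borel E s))"
  shows "integrable M (\<lambda>\<omega>. real (time_change N E t \<omega>))"
    and "(\<integral>\<omega>. (real (time_change N E t \<omega>) - real (time_change N E s \<omega>)) * indicator C \<omega> \<partial>M) =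
      lam * (\<integral>\<omega>. (E t \<omega> - E s \<omega>) * indicator C \<omega> \<partial>M)"
proof -
  let ?H = "generated_sigma M {0..} borel E"
  let ?J = "\<lambda>r. join_sigma M (past_increments M N r) ?H"
  let ?T = "\<lambda>r. {\<omega> \<in> space M. E s \<omega> < r}"
  have ind': "indep_set (sets (generated_sigma M {0..} (count_space UNIV) N)) (sets ?H)"
    using ind by (simp add: indep_families_def)
  then have HM: "sets ?H \<subseteq> events" and NM: "sets (generated_sigma M {0..} (count_space UNIV) N) \<subseteq> events"
    by (auto simp: indep_sets2_eq)
  have EH: "E u \<in> borel_measurable ?H" if "0 \<le> u" for u
    using that by (intro measurable_generated_sigma) auto
  have EM: "E u \<in> borel_measurable M" if "0 \<le> u" for u
    using EH[OF that] HM by (rule measurable_mono_sets) simp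
  have EJ: "E u \<in> borel_measurable (?J r)" if "0 \<le> u" for u r
    using EH[OF that] by (rule measurable_mono_sets) (simp_all add: sets_join_sigma2)
  have T: "?T r \<in> sets (?J r)" for r
    using measurable_sets[OF EJ[OF st(1), of r], of "{..<r}"] by (simp add: vimage_def Int_def conj_commute)
  have Nr: "(\<lambda>\<omega>. real (N v \<omega>)) \<in> borel_measurable M" if "0 \<le> v" for v
    using poisson_process_measurable[OF pp that] by measurable
  have N0: "AE \<omega> in M. N 0 \<omega> = 0" using pp by (simp add: poisson_process_def)
  have "C \<in> sets (trace_sigma M (?J r) (?T r))" if r: "0 \<le> r" for r
  proof -
    let ?K = "trace_sigma M (?J r) (?T r)"
    have "E u \<in> borel_measurable ?K" if "u \<in> {0..s}" for u
      using that by (intro measurable_trace_sigma[OF T _ EM EJ]) auto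
    moreover have "time_change N E u \<in> ?K \<rightarrow>\<^sub>M count_space UNIV" if u: "u \<in> {0..s}" for u
    proof -
      \<comment> \<open>on \<open>E s < r\<close> the clock at time \<open>u \<le> s\<close> has not passed \<open>r\<close>, so stopping \<open>N\<close> at \<open>r\<close> changes nothing\<close>
      let ?Z = "\<lambda>v \<omega>. real (N (min r v) \<omega>) - real (N 0 \<omega>)"
      have "(\<lambda>\<omega>. ?Z (E u \<omega>) \<omega>) \<in> borel_measurable (?J r)"
      proof (rule measurable_random_time[where Z="?Z"])
        show "?Z v \<in> borel_measurable (?J r)" if "0 \<le> v" for v
        proof (rule measurable_mono_sets)
          show "?Z v \<in> borel_measurable (past_increments M N r)"
            unfolding past_increments_def
            by (rule measurable_generated_sigma[of "min r v" _ "\<lambda>u \<omega>. real (N u \<omega>) - real (N 0 \<omega>)"])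
               (use r that in auto)
        qed (simp_all add: sets_join_sigma1)
        show "continuous (at_right v) (\<lambda>v. ?Z v \<omega>)" if "\<omega> \<in> space (?J r)" "0 \<le> v" for v \<omega>
          using right_continuous_min[OF poisson_process_continuous[OF pp, of \<omega> v], of r] that
          by (intro continuous_diff continuous_const) simp_all
      qed (use EJ u nn in auto)
      \<comment> \<open>The floor brings the real-valued stopped path back to the naturals; the
        subtracted N(0) vanishes almost surely.\<close>
      then have "(\<lambda>\<omega>. nat \<lfloor>?Z (E u \<omega>) \<omega>\<rfloor>) \<in> ?J r \<rightarrow>\<^sub>M count_space UNIV" by measurable
      moreover have "AE \<omega> in M. \<omega> \<in> ?T r \<longrightarrow> time_change N E u \<omega> = nat \<lfloor>?Z (E u \<omega>) \<omega>\<rfloor>"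
      proof -
        have "AE \<omega> in M. E u \<omega> \<le> E s \<omega>" using u by (intro mono) auto
        with N0 show ?thesis by eventually_elim (simp add: time_change_def min_def)
      qed
      moreover have "time_change N E u \<in> M \<rightarrow>\<^sub>M count_space UNIV"
      proof -
        have "(\<lambda>\<omega>. real (time_change N E u \<omega>)) \<in> borel_measurable M"
          unfolding time_change_def
          using measurable_random_time[of "\<lambda>u \<omega>. real (N u \<omega>)" M, OF Nr EM nn poisson_process_continuous[OF pp]] u
          by simp
        then have "(\<lambda>\<omega>. nat \<lfloor>real (time_change N E u \<omega>)\<rfloor>) \<in> M \<rightarrow>\<^sub>M count_space UNIV" by measurable
        then show ?thesis by simp
      qed
      ultimately show ?thesis using T by (intro measurable_trace_sigma) auto
    qed
    ultimately have "sets (join_sigma M (natural_filtration M (count_space UNIV) (time_change N E) s)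
          (natural_filtration M borel E s)) \<subseteq> sets ?K"
      unfolding natural_filtration_def
      by (intro sets_join_sigma_subset sets_generated_sigma_subset) simp_all
    then show ?thesis using C by auto
  qed
  note C' = this
  have t: "0 \<le> t" using st by simp
  show "integrable M (\<lambda>\<omega>. real (time_change N E t \<omega>))"
    unfolding time_change_def using C' nn mono[OF st]
    by (intro poisson_random_time_integral(1)[OF pp lam ind' _ EH[OF st(1)] EH[OF t] _ _ _ int[OF t]]) auto
  show "(\<integral>\<omega>. (real (time_change N E t \<omega>) - real (time_change N E s \<omega>)) * indicator C \<omega> \<partial>M) =
      lam * (\<integral>\<omega>. (E t \<omega> - E s \<omega>) * indicator C \<omega> \<partial>M)"
    unfolding time_change_def using C' nn mono[OF st]
    by (intro poisson_random_time_integral(2)[OF pp lam ind' _ EH[OF st(1)] EH[OF t] _ _ _ int[OF t]]) auto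
qed

text \<open>The number of jumps plays the role of time: C restricted to L \<le> n is known from the
  first n jumps and H, and X(n+1) is independent of both together. H also decides whether n <
  U.\<close>

lemma (in prob_space) compound_sum_integral:
  fixes X :: "nat \<Rightarrow> 'a \<Rightarrow> real" and L U :: "'a \<Rightarrow> nat"
  assumes X: "iid_with_law M FX X" and Xint: "\<And>i. i \<ge> 1 \<Longrightarrow> integrable M (X i)"
    and ind: "indep_set (sets (generated_sigma M {1..} borel X)) (sets H)"
    and spH: "space H = space M"
    and L: "L \<in> H \<rightarrow>\<^sub>M count_space UNIV" and U: "U \<in> H \<rightarrow>\<^sub>M count_space UNIV"
    and le: "AE \<omega> in M. L \<omega> \<le> U \<omega>" and int: "integrable M (\<lambda>\<omega>. real (U \<omega>))"
    and C: "\<And>n. C \<in> sets (trace_sigma M (join_sigma M (generated_sigma M {1..n} borel X) H)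
                           {\<omega> \<in> space M. L \<omega> \<le> n})"
  shows "integrable M (\<lambda>\<omega>. ((\<Sum>i=1..U \<omega>. X i \<omega>) - (\<Sum>i=1..L \<omega>. X i \<omega>)) * indicator C \<omega>)"
      (is "integrable M ?Z")
    and "(\<integral>\<omega>. ((\<Sum>i=1..U \<omega>. X i \<omega>) - (\<Sum>i=1..L \<omega>. X i \<omega>)) * indicator C \<omega> \<partial>M) =
      (\<integral>\<omega>. X 1 \<omega> \<partial>M) * (\<integral>\<omega>. (real (U \<omega>) - real (L \<omega>)) * indicator C \<omega> \<partial>M)"
proof -
  let ?G = "\<lambda>I. generated_sigma M I borel X"
  let ?J = "\<lambda>n. join_sigma M (?G {1..n}) H"
  have iv: "indep_vars (\<lambda>_. borel) X {1..}" and law: "\<And>i. i \<ge> 1 \<Longrightarrow> distr M borel (X i) = FX"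
    using X by (auto simp: iid_with_law_def)
  have HM: "sets H \<subseteq> events" and XM: "sets (?G {1..}) \<subseteq> events" using ind by (auto simp: indep_sets2_eq)
  have rv: "X i \<in> borel_measurable M" if "i \<ge> 1" for i
    using Xint[OF that] by auto
  have rvS[measurable]: "X (Suc i) \<in> borel_measurable M" for i by (rule rv) simp
  have [measurable]: "L \<in> M \<rightarrow>\<^sub>M count_space UNIV" "U \<in> M \<rightarrow>\<^sub>M count_space UNIV"
    using L U HM by (auto intro: measurable_mono_sets simp: spH)
  have HJ: "sets H \<subseteq> sets (?J n)" for n by (rule sets_join_sigma2) (simp_all add: spH)
  have gmono: "sets (?G I) \<subseteq> sets (?G I')" if "I \<subseteq> I'" for I I'
    using that by (intro sets_generated_sigma_subset measurable_generated_sigma) auto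
  have L_in: "{\<omega> \<in> space M. L \<omega> \<le> n} \<in> sets (?J n)" for n
    using measurable_sets[OF L, of "{..n}"] HJ[of n] by (auto simp: spH vimage_def Int_def conj_commute)
  have U_in: "{\<omega> \<in> space M. n < U \<omega>} \<in> sets (?J n)" for n
    using measurable_sets[OF U, of "{n<..}"] HJ[of n] by (auto simp: spH vimage_def Int_def conj_commute)
  note C' = C[unfolded sets_trace_sigma[OF L_in space_join_sigma]]
  have [measurable]: "C \<in> events" using C'[of 0] by auto
  have indJ: "indep_set (sets (?G {Suc n})) (sets (?J n))" for n
  proof (rule indep_set_join_sigma[OF _ ind])
    show "indep_set (sets (?G {Suc n})) (sets (?G {1..n}))"
      using iv by (rule indep_vars_generated_sigma) auto
    show "sets (?G {Suc n}) \<subseteq> sets (?G {1..})" by (rule gmono) simp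
    show "sets (?G {1..n}) \<subseteq> sets (?G {1..})" by (rule gmono) auto
  qed (simp_all add: spH)
  \<comment> \<open>The index is shifted by one: X(n+1) is among the jumps numbered above L and up
    to U exactly when L \<le> n < U.\<close>
  define B where "B n = {\<omega> \<in> space M. \<omega> \<in> C \<and> L \<omega> \<le> n \<and> n < U \<omega>}" for n
  have B: "B n \<in> events" for n unfolding B_def by measurable
  define K where "K \<omega> = (real (U \<omega>) - real (L \<omega>)) * indicator C \<omega>" for \<omega>
  have indB: "indicator (B n) \<omega> = (if n \<in> {L \<omega>..<U \<omega>} then indicator C \<omega> else 0 :: real)"
    if "\<omega> \<in> space M" for n \<omega>
    using that by (auto simp: B_def indicator_def)
  have law_int: "(\<integral>\<omega>. g (X (Suc n) \<omega>) \<partial>M) = (\<integral>\<omega>. g (X 1 \<omega>) \<partial>M)"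
    if [measurable]: "g \<in> borel_measurable borel" for g :: "real \<Rightarrow> real" and n
  proof -
    have "(\<integral>\<omega>. g (X i \<omega>) \<partial>M) = (\<integral>x. g x \<partial>FX)" if "i \<ge> 1" for i
      unfolding law[OF that, symmetric] using rv[OF that] by (subst integral_distr) auto
    then show ?thesis by simp
  qed
  \<comment> \<open>The identity as g gives the mean over \<open>B n\<close>; the absolute value
    gives the bound that makes the series summable.\<close>
  have mean_gen: "(\<integral>\<omega>. g (X (Suc n) \<omega>) * indicator (B n) \<omega> \<partial>M) = (\<integral>\<omega>. g (X 1 \<omega>) \<partial>M) * prob (B n)"
    if g[measurable]: "g \<in> borel_measurable borel" and gint: "integrable M (\<lambda>\<omega>. g (X (Suc n) \<omega>))"
    for g :: "real \<Rightarrow> real" and n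
  proof -
    obtain C'' where C'': "C'' \<in> sets (?J n)"
      and eq: "AE \<omega> in M. (\<omega> \<in> C \<and> \<omega> \<in> {\<omega> \<in> space M. L \<omega> \<le> n}) = (\<omega> \<in> C'')"
      using C'[of n] by auto
    let ?B = "C'' \<inter> {\<omega> \<in> space M. n < U \<omega>}"
    have B': "?B \<in> sets (?J n)" using C'' U_in by auto
    then have B'M[measurable]: "?B \<in> events" using indJ[of n] by (auto simp: indep_sets2_eq)
    have eq': "AE \<omega> in M. \<omega> \<in> B n \<longleftrightarrow> \<omega> \<in> ?B"
      using eq by eventually_elim (auto simp: B_def)
    have "(\<integral>\<omega>. g (X (Suc n) \<omega>) * indicator (B n) \<omega> \<partial>M) = (\<integral>\<omega>. g (X (Suc n) \<omega>) * indicator ?B \<omega> \<partial>M)"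
    proof (rule integral_cong_AE)
      show "AE \<omega> in M. g (X (Suc n) \<omega>) * indicator (B n) \<omega> = g (X (Suc n) \<omega>) * indicator ?B \<omega>"
        using eq' by eventually_elim (simp add: indicator_def)
    qed (use B B'M in measurable)
    also have "\<dots> = (\<integral>\<omega>. g (X (Suc n) \<omega>) \<partial>M) * (\<integral>\<omega>. indicator ?B \<omega> \<partial>M)"
    proof (rule indep_set_integral_mult(2)[OF indJ])
      have "X (Suc n) \<in> borel_measurable (?G {Suc n})" by (rule measurable_generated_sigma) auto
      then show "(\<lambda>\<omega>. g (X (Suc n) \<omega>)) \<in> borel_measurable (?G {Suc n})" by measurable
      show "indicator ?B \<in> borel_measurable (?J n)" using B' by simp
      show "integrable M (\<lambda>\<omega>. indicator ?B \<omega> :: real)"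
        using B'M by (intro integrable_real_indicator) (simp_all add: less_top[symmetric])
    qed (use gint in auto)
    also have "(\<integral>\<omega>. indicator ?B \<omega> \<partial>M) = prob ?B" using B'M by simp
    also have "prob ?B = prob (B n)" using eq' B B'M by (intro finite_measure_eq_AE) auto
    finally show ?thesis unfolding law_int[OF g] .
  qed
  have mean: "(\<integral>\<omega>. X (Suc n) \<omega> * indicator (B n) \<omega> \<partial>M) = (\<integral>\<omega>. X 1 \<omega> \<partial>M) * prob (B n)" for n
    using mean_gen[of "\<lambda>x. x" n] Xint by simp
  have mean_abs: "(\<integral>\<omega>. \<bar>X (Suc n) \<omega>\<bar> * indicator (B n) \<omega> \<partial>M) = (\<integral>\<omega>. \<bar>X 1 \<omega>\<bar> \<partial>M) * prob (B n)" for n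
    using mean_gen[of "\<lambda>x. \<bar>x\<bar>" n] Xint by simp
  have K: "integrable M K"
  proof (rule Bochner_Integration.integrable_bound[OF int])
    show "AE \<omega> in M. norm (K \<omega>) \<le> norm (real (U \<omega>))"
      using le by eventually_elim (auto simp: K_def indicator_def)
  qed (unfold K_def, measurable)
  have Ksums: "AE \<omega> in M. (\<lambda>n. indicator (B n) \<omega>) sums K \<omega>"
    using le AE_space
  proof eventually_elim
    case (elim \<omega>)
    have "(\<Sum>n\<in>{L \<omega>..<U \<omega>}. indicator C \<omega>) = K \<omega>"
      using elim by (simp add: K_def of_nat_diff)
    then show ?case
      using sums_If_finite_set[of "{L \<omega>..<U \<omega>}" "\<lambda>_. indicator C \<omega> :: real"]
      by (simp only: indB[OF elim(2)] finite_atLeastLessThan simp_thms)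
  qed
  have Zsums: "AE \<omega> in M. (\<lambda>n. X (Suc n) \<omega> * indicator (B n) \<omega>) sums ?Z \<omega>"
    using le AE_space
  proof eventually_elim
    case (elim \<omega>)
    let ?I = "{L \<omega>..<U \<omega>}"
    have "(\<Sum>n\<in>?I. X (Suc n) \<omega>) = (\<Sum>i=1..U \<omega>. X i \<omega>) - (\<Sum>i=1..L \<omega>. X i \<omega>)"
      using elim(1) sum_diff_nat_ivl[of 0 "L \<omega>" "U \<omega>" "\<lambda>n. X (Suc n) \<omega>"]
      by (simp add: sum.atLeast1_atMost_eq atLeast0LessThan)
    then have "(\<Sum>n\<in>?I. X (Suc n) \<omega> * indicator C \<omega>) = ?Z \<omega>" by (simp add: sum_distrib_right[symmetric])
    moreover have "(\<lambda>n. X (Suc n) \<omega> * indicator (B n) \<omega>) = (\<lambda>n. if n \<in> ?I then X (Suc n) \<omega> * indicator C \<omega> else 0)"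
      by (simp add: indB[OF elim(2)] fun_eq_iff)
    ultimately show ?case
      using sums_If_finite_set[of ?I "\<lambda>n. X (Suc n) \<omega> * indicator C \<omega>"]
      by (simp only: finite_atLeastLessThan simp_thms)
  qed
  have "(\<lambda>\<omega>. \<Sum>i=1..n. X i \<omega>) \<in> borel_measurable M" for n
    by (intro borel_measurable_sum rv) auto
  note V = measurable_compose_countable[where f="\<lambda>n \<omega>. \<Sum>i=1..n. X i \<omega>", OF this]
  have "?Z \<in> borel_measurable M"
    by (intro borel_measurable_times borel_measurable_diff V) simp_all
  note S = integral_sums_indicator[OF Xint[of "Suc _", simplified] B mean mean_abs K Ksums this Zsums]
  show "integrable M ?Z" by (rule S(1))
  show "(\<integral>\<omega>. ?Z \<omega> \<partial>M) = (\<integral>\<omega>. X 1 \<omega> \<partial>M) * (\<integral>\<omega>. (real (U \<omega>) - real (L \<omega>)) * indicator C \<omega> \<partial>M)"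
    using S(2) by (simp add: K_def)
qed

text \<open>Over a \<inter> b the integral factors into P(a) times the integral of \<phi> over b,
  which is 0; Dynkin's theorem extends this to the join. With S generated by the jumps, it carries
  the Poisson identity from the filtration of (N_f, E) to events that also involve Y.\<close>

lemma (in prob_space) integral_zero_join_sigma:
  fixes \<phi> :: "'a \<Rightarrow> real"
  assumes ind: "indep_set (sets S) (sets H)" and FH: "sets F \<subseteq> sets H"
    and sp: "space S = space M" "space H = space M" "space F = space M"
    and \<phi>: "\<phi> \<in> borel_measurable H" "integrable M \<phi>"
    and zero: "\<And>C. C \<in> sets F \<Longrightarrow> (\<integral>\<omega>. \<phi> \<omega> * indicator C \<omega> \<partial>M) = 0"
    and C: "C \<in> sets (join_sigma M S F)"
  shows "(\<integral>\<omega>. \<phi> \<omega> * indicator C \<omega> \<partial>M) = 0"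
proof -
  have SM: "sets S \<subseteq> events" and HM: "sets H \<subseteq> events" using ind by (auto simp: indep_sets2_eq)
  let ?G = "{a \<inter> b | a b. a \<in> sets S \<and> b \<in> sets F}"
  have G: "?G \<subseteq> Pow (space M)" using sets.sets_into_space[of _ S] sp by auto
  have GM: "sigma_sets (space M) ?G \<subseteq> events"
    using SM HM FH by (intro sets.sigma_sets_subset) auto
  have int: "integrable M (\<lambda>\<omega>. \<phi> \<omega> * indicator A \<omega>)" if "A \<in> events" for A
    using integrable_mult_indicator[OF that \<phi>(2)] by (simp add: mult.commute)
  show ?thesis
    using C unfolding sets_join_sigma_Int[OF sp(1,3)]
  proof (induction rule: sigma_sets_induct_disjoint[OF Int_stable_sets_Int G, consumes 1, case_names basic empty compl union])
    case (basic A)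
    then obtain a b where A: "A = a \<inter> b" and ab: "a \<in> sets S" "b \<in> sets F" by auto
    have "(\<integral>\<omega>. \<phi> \<omega> * indicator A \<omega> \<partial>M) = (\<integral>\<omega>. indicator a \<omega> * (\<phi> \<omega> * indicator b \<omega>) \<partial>M)"
      by (intro Bochner_Integration.integral_cong) (auto simp: A indicator_def)
    also have "\<dots> = (\<integral>\<omega>. indicator a \<omega> \<partial>M) * (\<integral>\<omega>. \<phi> \<omega> * indicator b \<omega> \<partial>M)"
    proof (rule indep_set_integral_mult(2)[OF ind sp(1,2)])
      show "indicator a \<in> borel_measurable S" using ab by simp
      show "integrable M (\<lambda>\<omega>. indicator a \<omega> :: real)"
        using ab SM by (intro integrable_real_indicator) (auto simp: less_top[symmetric])
      show "(\<lambda>\<omega>. \<phi> \<omega> * indicator b \<omega>) \<in> borel_measurable H"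
        using ab FH \<phi>(1) by (intro borel_measurable_times borel_measurable_indicator) auto
      show "integrable M (\<lambda>\<omega>. \<phi> \<omega> * indicator b \<omega>)" using ab FH HM by (intro int) auto
    qed
    finally show ?case using zero[OF ab(2)] by simp
  next
    case empty
    show ?case by simp
  next
    case (compl A)
    have [measurable]: "A \<in> events" using compl(1) GM by auto
    have "space M \<in> sets F" using sets.top[of F] sp by simp
    then have "0 = (\<integral>\<omega>. \<phi> \<omega> * indicator (space M) \<omega> \<partial>M)" by (rule zero[symmetric])
    also have "\<dots> = (\<integral>\<omega>. \<phi> \<omega> * indicator A \<omega> + \<phi> \<omega> * indicator (space M - A) \<omega> \<partial>M)"
      by (intro Bochner_Integration.integral_cong) (auto simp: indicator_def)
    also have "\<dots> = (\<integral>\<omega>. \<phi> \<omega> * indicator A \<omega> \<partial>M) + (\<integral>\<omega>. \<phi> \<omega> * indicator (space M - A) \<omega> \<partial>M)"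
      by (rule Bochner_Integration.integral_add) (auto intro!: int)
    finally show ?case using compl(2) by simp
  next
    case (union A)
    have [measurable]: "A i \<in> events" for i using union(2) GM by auto
    have "(\<integral>\<omega>. \<phi> \<omega> * indicator (\<Union>i. A i) \<omega> \<partial>M) = (\<integral>\<omega>\<in>(\<Union>i. A i). \<phi> \<omega> \<partial>M)"
      by (simp add: set_lebesgue_integral_def mult.commute)
    also have "\<dots> = (\<Sum>i. \<integral>\<omega>\<in>A i. \<phi> \<omega> \<partial>M)"
    proof (rule lebesgue_integral_countable_add)
      show "A i \<inter> A j = {}" if "i \<noteq> j" for i j using union(1) that by (auto simp: disjoint_family_on_def)
      show "set_integrable M (\<Union>i. A i) \<phi>"
        unfolding set_integrable_def using int[of "\<Union>i. A i"] by (simp add: mult.commute)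
    qed auto
    also have "\<dots> = 0" using union(3) by (simp add: set_lebesgue_integral_def mult.commute)
    finally show ?case .
  qed
qed

section \<open>From zero integrals to the martingale property\<close>

lemma (in prob_space) martingale_if_zero_integrals:
  assumes sub: "\<And>t. 0 \<le> t \<Longrightarrow> subalgebra M (F t)"
    and mono: "\<And>s t. 0 \<le> s \<Longrightarrow> s \<le> t \<Longrightarrow> subalgebra (F t) (F s)"
    and adapted: "\<And>t. 0 \<le> t \<Longrightarrow> Z t \<in> borel_measurable (F t)"
    and int: "\<And>t. 0 \<le> t \<Longrightarrow> integrable M (Z t)"
    and zero: "\<And>s t C. 0 \<le> s \<Longrightarrow> s \<le> t \<Longrightarrow> C \<in> sets (F s) \<Longrightarrow>
      (\<integral>\<omega>. (Z t \<omega> - Z s \<omega>) * indicator C \<omega> \<partial>M) = 0"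
  shows "martingale M F Z"
  unfolding martingale_def
proof (intro conjI allI impI; (elim conjE)?)
  fix s t :: real assume st: "0 \<le> s" "s \<le> t"
  interpret S: finite_measure_subalgebra M "F s"
    using sub[OF st(1)] by (intro finite_measure_subalgebra.intro finite_measure_subalgebra_axioms.intro finite_measure_axioms)
  show "AE \<omega> in M. real_cond_exp M (F s) (Z t) \<omega> = Z s \<omega>"
  proof (rule S.real_cond_exp_charact)
    fix C assume C: "C \<in> sets (F s)"
    then have [measurable]: "C \<in> events" using sub[OF st(1)] by (auto simp: subalgebra_def)
    have int': "integrable M (\<lambda>\<omega>. Z u \<omega> * indicator C \<omega>)" if "0 \<le> u" for u
      using integrable_mult_indicator[OF _ int[OF that], of C] by (simp add: mult.commute)
    have "(\<integral>\<omega>. Z t \<omega> * indicator C \<omega> - Z s \<omega> * indicator C \<omega> \<partial>M) = 0"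
      using zero[OF st C] by (simp add: left_diff_distrib)
    then have "(\<integral>\<omega>. Z t \<omega> * indicator C \<omega> \<partial>M) = (\<integral>\<omega>. Z s \<omega> * indicator C \<omega> \<partial>M)"
      using st int' by (subst (asm) Bochner_Integration.integral_diff) auto
    then show "(\<integral>\<omega>\<in>C. Z t \<omega> \<partial>M) = (\<integral>\<omega>\<in>C. Z s \<omega> \<partial>M)"
      by (simp add: set_lebesgue_integral_def mult.commute)
  qed (use st int adapted in auto)
qed (use assms in auto)

text \<open>F records jump times and the clock but not the jump sizes, so Y, and with it
  \<open>Mf\<close>, is in general not adapted to F. The martingale property is therefore stated for
  G, which adds the history of Y. For F itself the second conjunct keeps what is meaningful without
  adaptedness: increments have conditional mean zero.\<close>

theorem theorem3p3:
  fixes M :: "'a measure"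
    and b lam :: real and \<nu> FX :: "real measure"
    and D E :: "real \<Rightarrow> 'a \<Rightarrow> real" and N Nf :: "real \<Rightarrow> 'a \<Rightarrow> nat"
    and X :: "nat \<Rightarrow> 'a \<Rightarrow> real"
    and Y Mf :: "real \<Rightarrow> 'a \<Rightarrow> real"
    and F G :: "real \<Rightarrow> 'a measure"
  assumes "prob_space M"
    and "b \<ge> 0" and "levy_measure_pos \<nu>" and "emeasure \<nu> {0..} = \<infinity>"
    and "subordinator_with_exponent M (bernstein_fun b \<nu>) D"
    and E_def: "E = inverse_process D"
    and "lam > 0" and "poisson_process M lam N"
    and "indep_families M {0..} (count_space UNIV) N {0..} borel E"
    and Nf_def: "Nf = time_change N E"
    and "iid_with_law M FX X"
    and "indep_families M {1..} borel X
           {0..} (count_space UNIV \<Otimes>\<^sub>M borel) (\<lambda>t \<omega>. (Nf t \<omega>, E t \<omega>))"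
    and "\<And>i. i \<ge> 1 \<Longrightarrow> integrable M (X i)"
    and Y_def: "Y = compound_process X Nf"
    and Mf_def: "Mf = (\<lambda>t \<omega>. Y t \<omega> - lam * E t \<omega> * (\<integral>\<omega>'. X 1 \<omega>' \<partial>M))"
    and F_def: "F = join_filtration M (natural_filtration M (count_space UNIV) Nf)
                                      (natural_filtration M borel E)"
    and G_def: "G = join_filtration M F (natural_filtration M borel Y)"
  shows "martingale M G Mf \<and>
         (\<forall>s t. 0 \<le> s \<and> s \<le> t \<longrightarrow>
            (AE \<omega> in M. real_cond_exp M (F s) (\<lambda>\<omega>. Mf t \<omega> - Mf s \<omega>) \<omega> = 0))"
proof -
  interpret prob_space M by fact
  note D = assms(5) and lam = assms(7) and pp = assms(8) and NE = assms(9) and X = assms(11)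
    and Xint = assms(13)
  let ?HX = "generated_sigma M {1..} borel X"
  let ?H = "generated_sigma M {0..} (count_space UNIV \<Otimes>\<^sub>M borel) (\<lambda>t \<omega>. (Nf t \<omega>, E t \<omega>))"
  let ?J = "\<lambda>n. join_sigma M (generated_sigma M {1..n} borel X) ?H"
  let ?\<mu> = "\<integral>\<omega>. X 1 \<omega> \<partial>M"
  have pos: "0 < bernstein_fun b \<nu> 1"
    using assms(2-4) by (rule bernstein_fun_pos)
  have ind: "indep_set (sets ?HX) (sets ?H)" using assms(12) by (simp add: indep_families_def)
  then have XM: "sets ?HX \<subseteq> events" and HM: "sets ?H \<subseteq> events" by (auto simp: indep_sets2_eq)
  have pair: "(\<lambda>\<omega>. (Nf u \<omega>, E u \<omega>)) \<in> ?H \<rightarrow>\<^sub>M count_space UNIV \<Otimes>\<^sub>M borel" if "0 \<le> u" for u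
    using that by (intro measurable_generated_sigma[of u _ "\<lambda>t \<omega>. (Nf t \<omega>, E t \<omega>)"]) (auto simp: space_pair_measure)
  have NfH: "Nf u \<in> ?H \<rightarrow>\<^sub>M count_space UNIV" and EH: "E u \<in> borel_measurable ?H" if "0 \<le> u" for u
    using measurable_compose[OF pair[OF that] measurable_fst] measurable_compose[OF pair[OF that] measurable_snd]
    by simp_all
  have NfM: "Nf u \<in> M \<rightarrow>\<^sub>M count_space UNIV" and EM: "E u \<in> borel_measurable M" if "0 \<le> u" for u
    using measurable_mono_sets[OF NfH[OF that] HM] measurable_mono_sets[OF EH[OF that] HM] by simp_all
  have XX: "X i \<in> borel_measurable ?HX" if "1 \<le> i" for i
    using that by (intro measurable_generated_sigma) auto
  have Enn: "0 \<le> E t \<omega>" for t \<omega> by (simp add: E_def inverse_process_nonneg)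
  have Eint: "integrable M (E t)" if "0 \<le> t" for t
    unfolding E_def by (rule integrable_inverse_process[OF D pos EM[OF that, unfolded E_def]])
  have Emono: "AE \<omega> in M. E u \<omega> \<le> E v \<omega>" if "u \<le> v" for u v
    using subordinator_exceeds[OF D pos, of v]
    by eventually_elim (simp add: E_def inverse_process_mono[OF that])
  have Nfmono: "AE \<omega> in M. Nf u \<omega> \<le> Nf v \<omega>" if "u \<le> v" for u v
    using Emono[OF that] AE_space
    by eventually_elim (simp add: Nf_def time_change_def poisson_process_mono[OF pp] Enn)
  have F_eq: "F s = join_sigma M (natural_filtration M (count_space UNIV) Nf s) (natural_filtration M borel E s)" for s
    by (simp add: F_def join_filtration_eq)
  have G_eq: "G s = join_sigma M (F s) (natural_filtration M borel Y s)" for s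
    by (simp add: G_def join_filtration_eq)
  have spF [simp]: "space (F s) = space M" and spG [simp]: "space (G s) = space M" for s
    by (simp_all add: F_eq G_eq)
  have spN [simp]: "space (natural_filtration M S Z s) = space M" for S :: "'c measure" and Z s
    by (simp add: natural_filtration_def)
  have F_sub: "sets (F s) \<subseteq> sets K"
    if "space K = space M" "\<And>u. u \<in> {0..s} \<Longrightarrow> Nf u \<in> K \<rightarrow>\<^sub>M count_space UNIV"
      "\<And>u. u \<in> {0..s} \<Longrightarrow> E u \<in> borel_measurable K" for s K
    unfolding F_eq natural_filtration_def using that
    by (intro sets_join_sigma_subset sets_generated_sigma_subset) simp_all
  have G_sub: "sets (G s) \<subseteq> sets K"
    if "space K = space M" "\<And>u. u \<in> {0..s} \<Longrightarrow> Nf u \<in> K \<rightarrow>\<^sub>M count_space UNIV"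
      "\<And>u. u \<in> {0..s} \<Longrightarrow> E u \<in> borel_measurable K"
      "\<And>u. u \<in> {0..s} \<Longrightarrow> Y u \<in> borel_measurable K" for s K
    unfolding G_eq natural_filtration_def using that F_sub[of K s]
    by (intro sets_join_sigma_subset sets_generated_sigma_subset) simp_all
  have FG: "sets (F s) \<subseteq> sets (G s)" for s
    unfolding G_eq by (rule sets_join_sigma1) simp_all
  have NfF: "Nf u \<in> F s \<rightarrow>\<^sub>M count_space UNIV" if "u \<in> {0..s}" for u s
  proof -
    have "Nf u \<in> natural_filtration M (count_space UNIV) Nf s \<rightarrow>\<^sub>M count_space UNIV"
      unfolding natural_filtration_def using that by (intro measurable_generated_sigma) auto
    then show ?thesis
      unfolding F_eq by (rule measurable_mono_sets) (simp_all add: sets_join_sigma1)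
  qed
  have EF: "E u \<in> borel_measurable (F s)" if "u \<in> {0..s}" for u s
  proof -
    have "E u \<in> borel_measurable (natural_filtration M borel E s)"
      unfolding natural_filtration_def using that by (intro measurable_generated_sigma) auto
    then show ?thesis
      unfolding F_eq by (rule measurable_mono_sets) (simp_all add: sets_join_sigma2)
  qed
  have YG: "Y u \<in> borel_measurable (G s)" if "u \<in> {0..s}" for u s
  proof -
    have "Y u \<in> borel_measurable (natural_filtration M borel Y s)"
      unfolding natural_filtration_def using that by (intro measurable_generated_sigma) auto
    then show ?thesis
      unfolding G_eq by (rule measurable_mono_sets) (simp_all add: sets_join_sigma2)
  qed
  have NfG: "Nf u \<in> G s \<rightarrow>\<^sub>M count_space UNIV" and EG: "E u \<in> borel_measurable (G s)"
    if "u \<in> {0..s}" for u s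
    using measurable_mono_sets[OF NfF[OF that] FG] measurable_mono_sets[OF EF[OF that] FG] by simp_all
  \<comment> \<open>The bound on V means that only the first n jumps must be measurable for K; this
    is the information available on the event N_f(s) \<le> n.\<close>
  have compound: "(\<lambda>\<omega>. \<Sum>i=1..V \<omega>. X i \<omega>) \<in> borel_measurable K"
    if V: "V \<in> K \<rightarrow>\<^sub>M count_space UNIV" and le: "\<And>\<omega>. V \<omega> \<le> n"
      and XK: "\<And>i. 1 \<le> i \<Longrightarrow> i \<le> n \<Longrightarrow> X i \<in> borel_measurable K" for V K n
  proof -
    have "(\<lambda>\<omega>. \<Sum>i=1..min n k. X i \<omega>) \<in> borel_measurable K" for k
      by (intro borel_measurable_sum XK) auto
    from measurable_compose_countable[where f="\<lambda>k \<omega>. \<Sum>i=1..min n k. X i \<omega>", OF this V]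
    show ?thesis using le by (simp add: min_absorb2)
  qed
  have compound': "Y u \<in> borel_measurable K"
    if V: "Nf u \<in> K \<rightarrow>\<^sub>M count_space UNIV"
      and XK: "\<And>i. 1 \<le> i \<Longrightarrow> X i \<in> borel_measurable K" for u K
  proof -
    have "(\<lambda>\<omega>. \<Sum>i=1..k. X i \<omega>) \<in> borel_measurable K" for k
      by (intro borel_measurable_sum XK) auto
    from measurable_compose_countable[where f="\<lambda>k \<omega>. \<Sum>i=1..k. X i \<omega>", OF this V]
    show ?thesis by (simp add: Y_def compound_process_def[abs_def])
  qed
  have XMi: "X i \<in> borel_measurable M" if "1 \<le> i" for i
    using Xint[OF that] by simp
  have YM: "Y u \<in> borel_measurable M" if "0 \<le> u" for u
    using NfM[OF that] XMi by (rule compound')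
  have FH: "sets (F s) \<subseteq> sets ?H" for s
    by (rule F_sub) (auto intro: NfH EH)
  have GM: "sets (G s) \<subseteq> events" for s
    by (rule G_sub) (auto intro: NfM EM YM)
  \<comment> \<open>Y(u) is a function of N_f(u) and the jumps, so the history of Y adds to F at
    most information independent of (N_f, E).\<close>
  have GJ: "sets (G s) \<subseteq> sets (join_sigma M ?HX (F s))" for s
  proof (rule G_sub)
    let ?K = "join_sigma M ?HX (F s)"
    have FK: "sets (F s) \<subseteq> sets ?K" by (rule sets_join_sigma2) simp_all
    show N: "Nf u \<in> ?K \<rightarrow>\<^sub>M count_space UNIV" and "E u \<in> borel_measurable ?K" if "u \<in> {0..s}" for u
      using measurable_mono_sets[OF NfF[OF that] FK] measurable_mono_sets[OF EF[OF that] FK] by simp_all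
    show "Y u \<in> borel_measurable ?K" if "u \<in> {0..s}" for u
      using N[OF that]
    proof (rule compound')
      show "X i \<in> borel_measurable ?K" if "1 \<le> i" for i
        using XX[OF that] by (rule measurable_mono_sets) (simp_all add: sets_join_sigma1)
    qed
  qed simp
  have HJ: "sets ?H \<subseteq> sets (?J n)" for n by (rule sets_join_sigma2) simp_all
  have T: "{\<omega> \<in> space M. Nf s \<omega> \<le> n} \<in> sets (?J n)" if "0 \<le> s" for s n
    using measurable_sets[OF NfH[OF that], of "{..n}"] HJ[of n]
    by (auto simp: vimage_def Int_def conj_commute)
  \<comment> \<open>N_f(u) and E(u) are measurable for \<open>?H\<close> outright; only Y(u) needs
    the trace. If N_f(s) \<le> n and u \<le> s, almost surely at most n jumps have entered Y(u), so
    truncating the sum at n changes nothing.\<close>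
  have Gtrace: "sets (G s) \<subseteq> sets (trace_sigma M (?J n) {\<omega> \<in> space M. Nf s \<omega> \<le> n})" if s: "0 \<le> s" for s n
  proof (rule G_sub)
    fix u assume u: "u \<in> {0..s}"
    then have u0: "0 \<le> u" by simp
    have NfJ: "Nf u \<in> ?J n \<rightarrow>\<^sub>M count_space UNIV" and EJ: "E u \<in> borel_measurable (?J n)"
      using measurable_mono_sets[OF NfH[OF u0] HJ] measurable_mono_sets[OF EH[OF u0] HJ] by simp_all
    show "Nf u \<in> trace_sigma M (?J n) {\<omega> \<in> space M. Nf s \<omega> \<le> n} \<rightarrow>\<^sub>M count_space UNIV"
      by (rule measurable_trace_sigma[OF T[OF s] _ NfM[OF u0] NfJ]) simp_all
    show "E u \<in> borel_measurable (trace_sigma M (?J n) {\<omega> \<in> space M. Nf s \<omega> \<le> n})"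
      by (rule measurable_trace_sigma[OF T[OF s] _ EM[OF u0] EJ]) simp_all
    have XJ: "X i \<in> borel_measurable (?J n)" if "1 \<le> i" "i \<le> n" for i
    proof -
      have "X i \<in> borel_measurable (generated_sigma M {1..n} borel X)"
        using that by (intro measurable_generated_sigma) auto
      then show ?thesis by (rule measurable_mono_sets) (simp_all add: sets_join_sigma1)
    qed
    have "(\<lambda>\<omega>. min n (Nf u \<omega>)) \<in> ?J n \<rightarrow>\<^sub>M count_space UNIV" using NfJ by measurable
    from compound[OF this min.cobounded1 XJ]
    have g: "(\<lambda>\<omega>. \<Sum>i=1..min n (Nf u \<omega>). X i \<omega>) \<in> borel_measurable (?J n)"
      by simp
    have "AE \<omega> in M. \<omega> \<in> {\<omega> \<in> space M. Nf s \<omega> \<le> n} \<longrightarrow> Y u \<omega> = (\<Sum>i=1..min n (Nf u \<omega>). X i \<omega>)"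
      using Nfmono[of u s] u by (auto simp: Y_def compound_process_def min_absorb2 elim!: eventually_mono)
    then show "Y u \<in> borel_measurable (trace_sigma M (?J n) {\<omega> \<in> space M. Nf s \<omega> \<le> n})"
      by (intro measurable_trace_sigma[OF T[OF s] _ YM[OF u0] g]) simp_all
  qed simp
  \<comment> \<open>Only integrability is wanted here, so the empty event serves as C.\<close>
  have NfI: "integrable M (\<lambda>\<omega>. real (Nf t \<omega>))" if "0 \<le> t" for t
    unfolding Nf_def
    by (rule time_changed_poisson_compensator(1)[OF pp lam NE, of 0 t "{}"])
       (use that Enn Emono Eint in auto)
  have Poisson: "(\<integral>\<omega>. (real (Nf t \<omega>) - real (Nf s \<omega>)) * indicator C \<omega> \<partial>M) =
      lam * (\<integral>\<omega>. (E t \<omega> - E s \<omega>) * indicator C \<omega> \<partial>M)"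
    if "0 \<le> s" "s \<le> t" "C \<in> sets (F s)" for s t C
    unfolding Nf_def
    by (rule time_changed_poisson_compensator(2)[OF pp lam NE])
       (use that Enn Emono Eint in \<open>auto simp: F_eq Nf_def\<close>)
  have YI: "integrable M (Y t)" if t: "0 \<le> t" for t
  proof -
    \<comment> \<open>The lower count is 0 and C is the whole space, so the difference of sums is
      Y(t) itself.\<close>
    have "integrable M (\<lambda>\<omega>. ((\<Sum>i=1..Nf t \<omega>. X i \<omega>) - (\<Sum>i=1..(0::nat). X i \<omega>)) * indicator (space M) \<omega>)"
    proof (rule compound_sum_integral(1)[OF X Xint ind _ _ NfH[OF t] _ NfI[OF t]])
      show "space M \<in> sets (trace_sigma M (?J n) {\<omega> \<in> space M. 0 \<le> n})" for n
        using sets.top[of "trace_sigma M (?J n) {\<omega> \<in> space M. 0 \<le> n}"] by simp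
    qed simp_all
    then show ?thesis
      by (subst (asm) Bochner_Integration.integrable_cong[OF refl, of _ _ "Y t"])
         (auto simp: Y_def compound_process_def)
  qed
  have intC: "integrable M (\<lambda>\<omega>. f \<omega> * indicator C \<omega>)" if "integrable M f" "C \<in> events" for f :: "'a \<Rightarrow> real" and C
    using integrable_mult_indicator[OF that(2,1)] by (simp add: mult.commute)
  have zero: "(\<integral>\<omega>. (Mf t \<omega> - Mf s \<omega>) * indicator C \<omega> \<partial>M) = 0"
    if s: "0 \<le> s" and st: "s \<le> t" and C: "C \<in> sets (G s)" for s t C
  proof -
    have t: "0 \<le> t" using s st by simp
    have CM: "C \<in> events" using C GM by auto
    let ?dN = "\<lambda>\<omega>. real (Nf t \<omega>) - real (Nf s \<omega>)" and ?dE = "\<lambda>\<omega>. E t \<omega> - E s \<omega>"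
    have dN: "integrable M ?dN" and dE: "integrable M ?dE" and dY: "integrable M (\<lambda>\<omega>. Y t \<omega> - Y s \<omega>)"
      using NfI[OF s] NfI[OF t] Eint[OF s] Eint[OF t] YI[OF s] YI[OF t] by simp_all
    \<comment> \<open>The compensated count has zero integral over events of F; as it is a function
      of (N_f, E), independence from the jumps extends this to C in G.\<close>
    have "(\<integral>\<omega>. (?dN \<omega> - lam * ?dE \<omega>) * indicator C \<omega> \<partial>M) = 0"
    proof (rule integral_zero_join_sigma[OF ind FH])
      show "C \<in> sets (join_sigma M ?HX (F s))" using C GJ by auto
      show "(\<integral>\<omega>. (?dN \<omega> - lam * ?dE \<omega>) * indicator C' \<omega> \<partial>M) = 0" if C': "C' \<in> sets (F s)" for C'
      proof -
        have C'M: "C' \<in> events" using C' FH HM by blast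
        have "(\<integral>\<omega>. (?dN \<omega> - lam * ?dE \<omega>) * indicator C' \<omega> \<partial>M) =
            (\<integral>\<omega>. ?dN \<omega> * indicator C' \<omega> - lam * (?dE \<omega> * indicator C' \<omega>) \<partial>M)"
          by (simp add: algebra_simps)
        also have "\<dots> = (\<integral>\<omega>. ?dN \<omega> * indicator C' \<omega> \<partial>M) - lam * (\<integral>\<omega>. ?dE \<omega> * indicator C' \<omega> \<partial>M)"
          using intC[OF dN C'M] intC[OF dE C'M] by simp
        finally show ?thesis using Poisson[OF s st C'] by simp
      qed
      show "(\<lambda>\<omega>. ?dN \<omega> - lam * ?dE \<omega>) \<in> borel_measurable ?H"
        using NfH[OF s] NfH[OF t] EH[OF s] EH[OF t] by measurable
    qed (use dN dE in simp_all)
    then have "(\<integral>\<omega>. ?dN \<omega> * indicator C \<omega> - lam * (?dE \<omega> * indicator C \<omega>) \<partial>M) = 0"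
      by (simp add: algebra_simps)
    then have NE: "(\<integral>\<omega>. ?dN \<omega> * indicator C \<omega> \<partial>M) = lam * (\<integral>\<omega>. ?dE \<omega> * indicator C \<omega> \<partial>M)"
      using intC[OF dN CM] intC[OF dE CM] by simp
    \<comment> \<open>Here events of G must be tested directly, since Y(t) - Y(s) involves the
      jumps; the trace inclusion shows that C says nothing about the jumps after time s.\<close>
    have "(\<integral>\<omega>. (Y t \<omega> - Y s \<omega>) * indicator C \<omega> \<partial>M) = ?\<mu> * (\<integral>\<omega>. ?dN \<omega> * indicator C \<omega> \<partial>M)"
      unfolding Y_def compound_process_def
      by (rule compound_sum_integral(2)[OF X Xint ind _ NfH[OF s] NfH[OF t] Nfmono[OF st] NfI[OF t]])
         (use Gtrace[OF s] C in auto)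
    also have "\<dots> = ?\<mu> * lam * (\<integral>\<omega>. ?dE \<omega> * indicator C \<omega> \<partial>M)" by (simp add: NE)
    finally have YE: "(\<integral>\<omega>. (Y t \<omega> - Y s \<omega>) * indicator C \<omega> \<partial>M) = ?\<mu> * lam * (\<integral>\<omega>. ?dE \<omega> * indicator C \<omega> \<partial>M)" .
    have "(\<integral>\<omega>. (Mf t \<omega> - Mf s \<omega>) * indicator C \<omega> \<partial>M) =
        (\<integral>\<omega>. (Y t \<omega> - Y s \<omega>) * indicator C \<omega> - ?\<mu> * lam * (?dE \<omega> * indicator C \<omega>) \<partial>M)"
      by (simp add: Mf_def algebra_simps)
    also have "\<dots> = (\<integral>\<omega>. (Y t \<omega> - Y s \<omega>) * indicator C \<omega> \<partial>M) - ?\<mu> * lam * (\<integral>\<omega>. ?dE \<omega> * indicator C \<omega> \<partial>M)"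
      using intC[OF dY CM] intC[OF dE CM] by simp
    finally show ?thesis by (simp add: YE)
  qed
  have MfI: "integrable M (Mf t)" if "0 \<le> t" for t
    unfolding Mf_def using YI[OF that] Eint[OF that] by simp
  have "martingale M G Mf"
  proof (rule martingale_if_zero_integrals)
    show "subalgebra M (G t)" for t using GM by (simp add: subalgebra_def)
    show "subalgebra (G t) (G s)" if "s \<le> t" for s t
      unfolding subalgebra_def
    proof
      show "sets (G s) \<subseteq> sets (G t)"
        by (rule G_sub) (use that in \<open>auto intro!: NfG EG YG\<close>)
    qed simp
    show "Mf t \<in> borel_measurable (G t)" if "0 \<le> t" for t
      unfolding Mf_def using EG[of t t] YG[of t t] that by simp
  qed (fact MfI zero)+
  moreover have "AE \<omega> in M. real_cond_exp M (F s) (\<lambda>\<omega>. Mf t \<omega> - Mf s \<omega>) \<omega> = 0"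
    if s: "0 \<le> s" and st: "s \<le> t" for s t
  proof -
    have "subalgebra M (F s)" using FG GM by (force simp: subalgebra_def)
    then interpret S: finite_measure_subalgebra M "F s" by unfold_locales
    show ?thesis
    proof (rule S.real_cond_exp_charact)
      fix C assume "C \<in> sets (F s)"
      then have "C \<in> sets (G s)" using FG by auto
      from zero[OF s st this]
      show "(\<integral>\<omega>\<in>C. Mf t \<omega> - Mf s \<omega> \<partial>M) = (\<integral>\<omega>\<in>C. 0 \<partial>M)"
        by (simp add: set_lebesgue_integral_def mult.commute)
    qed (use MfI s st in auto)
  qed
  ultimately show ?thesis by blast
qed

end
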